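(* Let $\mathbf{k}$ be a field of characteristic zero, let $n\ge 1$, and let $\mathrm{GL}_n(\mathbf{k})$ act on $\mathrm{M}_n(\mathbf{k})$ by conjugation, $X\mapsto gXg^{-1}$. Then the $\mathbf{k}$-algebra $\Omega(\mathrm{M}_n(\mathbf{k}))^{\mathrm{GL}_n(\mathbf{k})}$ of all $\mathrm{GL}_n(\mathbf{k})$-invariant differential forms with polynomial coefficients on $\mathrm{M}_n(\mathbf{k})$ is generated, as a $\mathbf{k}$-algebra under the wedge product, by the functions $\mathrm{Tr}(X^{\ell})$ ($\ell\ge 1$) together with the forms $$\omega^{\ell_1\ell_2\cdots\ell_p}=\mathrm{Tr}\left(X^{\ell_1}dX\wedge X^{\ell_2}dX\wedge\cdots\wedge X^{\ell_p}dX\right)\qquad (p\ge 1,\ \ell_1,\dots,\ell_p\ge 0).$$ In other words, every invariant form is a $\mathbf{k}$-linear combination of (possibly empty) wedge products of forms of these types.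
   Context: $\mathrm{M}_n(\mathbf{k})$ is the space of $n\times n$ matrices over $\mathbf{k}$, with coordinate functions $x_{ij}$ ($1\le i,j\le n$). The algebra of differential forms with polynomial coefficients on $\mathrm{M}_n(\mathbf{k})$ is $$\Omega(\mathrm{M}_n(\mathbf{k}))=\mathbf{k}[x_{ij}]\otimes_{\mathbf{k}}\Lambda\Big(\bigoplus_{i,j}\mathbf{k}\,dx_{ij}\Big),$$ the tensor product of the polynomial ring in the $n^2$ variables $x_{ij}$ with the exterior algebra on the $n^2$ symbols $dx_{ij}$; polynomials commute with all forms. Write $X=(x_{ij})_{i,j=1}^n$ and $dX=(dx_{ij})_{i,j=1}^n$ for the matrices of coordinate functions and of their differentials. An element $g\in\mathrm{GL}_n(\mathbf{k})$ acts on $\Omega(\mathrm{M}_n(\mathbf{k}))$ by pullback along $X\mapsto gXg^{-1}$, i.e. by the $\mathbf{k}$-algebra automorphism sending each $x_{ij}$ to the $(i,j)$ entry of $gXg^{-1}$ and each $dx_{ij}$ to the $(i,j)$ entry of $g\,(dX)\,g^{-1}$. A form is invariant if it is fixed by all $g\in\mathrm{GL}_n(\mathbf{k})$. Explicitly, for $p\ge 1$ and $\ell_1,\dots,\ell_p\ge 0$, $$\omega^{\ell_1\ell_2\cdots\ell_p}=\sum_{i_1,\dots,i_p,j_1,\dots,j_p=1}^{n}(X^{\ell_1})_{i_1j_1}dx_{j_1i_2}\wedge(X^{\ell_2})_{i_2j_2}dx_{j_2i_3}\wedge\cdots\wedge(X^{\ell_p})_{i_pj_p}dx_{j_pi_1},$$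 where $(X^{\ell})_{ij}$ denotes the $(i,j)$ entry of $X^{\ell}$ and $X^0$ is the identity matrix. *)

theory Defs
  imports "HOL-Analysis.Determinants" "HOL-Library.Poly_Mapping"
begin

section \<open>Evaluation of \<^type>\<open>poly_mapping\<close>\<close>

lemma poly_mapping_monomial_induct [case_names zero monomial add]:
  fixes f :: "'a \<Rightarrow>\<^sub>0 'b::comm_monoid_add"
  assumes "P 0" "\<And>k c. P (Poly_Mapping.single k c)" "\<And>f g. P f \<Longrightarrow> P g \<Longrightarrow> P (f + g)"
  shows "P f"
proof -
  have "f = (\<Sum>k\<in>Poly_Mapping.keys f. Poly_Mapping.single k (Poly_Mapping.lookup f k))"
    by (rule poly_mapping_eqI) (auto simp: lookup_sum lookup_single when_def in_keys_iff)
  moreover have "P (\<Sum>k\<in>A. Poly_Mapping.single k (Poly_Mapping.lookup f k))" if "finite A" for A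
    using that by induction (auto intro: assms)
  ultimately show ?thesis by (metis finite_keys)
qed

definition pm_eval :: "('c::zero \<Rightarrow> 'r::ring_1) \<Rightarrow> ('m \<Rightarrow> 'r) \<Rightarrow> ('m \<Rightarrow>\<^sub>0 'c) \<Rightarrow> 'r" where
  "pm_eval \<phi> M f = (\<Sum>k\<in>Poly_Mapping.keys f. \<phi> (Poly_Mapping.lookup f k) * M k)"

lemma pm_eval_single:
  assumes "\<phi> 0 = 0"
  shows "pm_eval \<phi> M (Poly_Mapping.single k c) = \<phi> c * M k"
  using assms by (simp add: pm_eval_def)

lemma pm_eval_zero: "pm_eval \<phi> M 0 = 0"
  by (simp add: pm_eval_def)

lemma pm_eval_add:
  fixes \<phi> :: "'c::comm_monoid_add \<Rightarrow> 'r::ring_1"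
  assumes "\<phi> 0 = 0" "\<And>a b. \<phi> (a + b) = \<phi> a + \<phi> b"
  shows "pm_eval \<phi> M (f + g) = pm_eval \<phi> M f + pm_eval \<phi> M g"
proof -
  let ?S = "Poly_Mapping.keys f \<union> Poly_Mapping.keys g"
  have *: "pm_eval \<phi> M h = (\<Sum>k\<in>?S. \<phi> (Poly_Mapping.lookup h k) * M k)"
    if "Poly_Mapping.keys h \<subseteq> ?S" for h
    unfolding pm_eval_def using that assms(1)
    by (intro sum.mono_neutral_left) (auto simp: in_keys_iff)
  have "Poly_Mapping.keys (f + g) \<subseteq> ?S" by (rule keys_add)
  then show ?thesis
    by (simp add: * lookup_add assms(2) distrib_right sum.distrib)
qed

lemma pm_eval_mult:
  fixes \<phi> :: "'c::ring_1 \<Rightarrow> 'r::ring_1" and M :: "'m::monoid_add \<Rightarrow> 'r"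
  assumes \<phi>: "\<phi> 0 = 0" "\<And>a b. \<phi> (a + b) = \<phi> a + \<phi> b" "\<And>a b. \<phi> (a * b) = \<phi> a * \<phi> b"
    and M: "\<And>k l. M (k + l) = M k * M l" and comm: "\<And>k c. M k * \<phi> c = \<phi> c * M k"
  shows "pm_eval \<phi> M (f * g) = pm_eval \<phi> M f * pm_eval \<phi> M g"
proof (induction f rule: poly_mapping_monomial_induct)
  case (monomial k c)
  show ?case
  proof (induction g rule: poly_mapping_monomial_induct)
    case (monomial l d)
    have "\<phi> c * \<phi> d * (M k * M l) = \<phi> c * (\<phi> d * M k) * M l" by (simp add: mult.assoc)
    also have "\<dots> = \<phi> c * (M k * \<phi> d) * M l" by (simp only: comm)
    also have "\<dots> = \<phi> c * M k * (\<phi> d * M l)" by (simp add: mult.assoc)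
    finally show ?case by (simp add: mult_single pm_eval_single \<phi> M)
  qed (simp_all add: pm_eval_zero pm_eval_add \<phi> distrib_left)
qed (simp_all add: pm_eval_zero pm_eval_add \<phi> distrib_right)


section \<open>Exterior algebras\<close>

text \<open>
  A copy of the list type, so that concatenation can be made the addition of \<^class>\<open>monoid_add\<close>
  without instantiating that class for lists.  With these keys, the convolution product of
  \<^type>\<open>poly_mapping\<close> is the product of the free associative algebra, i.e. of the tensor
  algebra of the free module on \<open>'v\<close>.
\<close>

datatype 'v free_monoid = Free (letters: "'v list")

instantiation free_monoid :: (type) monoid_add
begin
definition "0 = Free []"
definition "u + v = Free (letters u @ letters v)"
instance by standard (simp_all add: zero_free_monoid_def plus_free_monoid_def)
end

type_synonym ('v, 'k) tensor_algebra = "'v free_monoid \<Rightarrow>\<^sub>0 'k"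

definition tensor_degree_one :: "('v, 'k::zero) tensor_algebra \<Rightarrow> bool" where
  "tensor_degree_one t \<longleftrightarrow> (\<forall>w \<in> Poly_Mapping.keys t. length (letters w) = 1)"

inductive_set exterior_ideal :: "('v, 'k::comm_ring_1) tensor_algebra set" where
  zero: "0 \<in> exterior_ideal"
| add: "s \<in> exterior_ideal \<Longrightarrow> t \<in> exterior_ideal \<Longrightarrow> s + t \<in> exterior_ideal"
| square: "tensor_degree_one v \<Longrightarrow> a * (v * v) * b \<in> exterior_ideal"

lemma exterior_ideal_mult_left: "t \<in> exterior_ideal \<Longrightarrow> c * t \<in> exterior_ideal"
proof (induction rule: exterior_ideal.induct)
  case (square v a b)
  then show ?case using exterior_ideal.square[of v "c * a" b] by (simp add: mult.assoc)
qed (simp_all add: exterior_ideal.zero exterior_ideal.add distrib_left)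

lemma exterior_ideal_mult_right: "t \<in> exterior_ideal \<Longrightarrow> t * c \<in> exterior_ideal"
proof (induction rule: exterior_ideal.induct)
  case (square v a b)
  then show ?case using exterior_ideal.square[of v a "b * c"] by (simp add: mult.assoc)
qed (simp_all add: exterior_ideal.zero exterior_ideal.add distrib_right)

lemma exterior_ideal_uminus: "t \<in> exterior_ideal \<Longrightarrow> - t \<in> exterior_ideal"
  using exterior_ideal_mult_left[of t "- 1"] by simp

lemma exterior_ideal_diff:
  "s \<in> exterior_ideal \<Longrightarrow> t \<in> exterior_ideal \<Longrightarrow> s - t \<in> exterior_ideal"
  using exterior_ideal.add[of s "- t"] exterior_ideal_uminus[of t] by simp

lemma lookup_zero_mult:
  "Poly_Mapping.lookup (s * t) 0 = Poly_Mapping.lookup s 0 * Poly_Mapping.lookup t (0 :: 'v free_monoid)"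
  for s t :: "('v, 'k::comm_ring_1) tensor_algebra"
proof -
  have zero_iff: "0 = l + q \<longleftrightarrow> l = 0 \<and> q = 0" for l q :: "'v free_monoid"
    by (cases l; cases q) (auto simp: zero_free_monoid_def plus_free_monoid_def)
  have "Poly_Mapping.lookup (s * t) 0 = (\<Sum>l. Poly_Mapping.lookup s l * (\<Sum>q. Poly_Mapping.lookup t q when 0 = l + q))"
    by (simp add: lookup_mult)
  also have "\<dots> = (\<Sum>l. Poly_Mapping.lookup s l * (\<Sum>q. (Poly_Mapping.lookup t q when l = 0) when q = 0))"
    by (intro arg_cong[where f = Sum_any] ext arg_cong2[where f = "(*)"] refl) (auto simp: zero_iff when_def)
  also have "\<dots> = (\<Sum>l. (Poly_Mapping.lookup s l * Poly_Mapping.lookup t 0) when l = 0)"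
    by (intro arg_cong[where f = Sum_any] ext) (simp add: when_def)
  finally show ?thesis by simp
qed

lemma exterior_ideal_lookup_zero: "t \<in> exterior_ideal \<Longrightarrow> Poly_Mapping.lookup t 0 = 0"
proof (induction rule: exterior_ideal.induct)
  case (square v a b)
  then have "(0 :: 'a free_monoid) \<notin> Poly_Mapping.keys v"
    by (force simp: tensor_degree_one_def zero_free_monoid_def)
  then show ?case by (simp add: lookup_zero_mult in_keys_iff)
qed (simp_all add: lookup_add)

definition exterior_rel ::
  "('v, 'k::comm_ring_1) tensor_algebra \<Rightarrow> ('v, 'k) tensor_algebra \<Rightarrow> bool" where
  "exterior_rel s t \<longleftrightarrow> s - t \<in> exterior_ideal"

lemma equivp_exterior_rel: "equivp exterior_rel"
proof (rule equivpI)
  show "reflp exterior_rel" by (simp add: reflp_def exterior_rel_def exterior_ideal.zero)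
  show "symp exterior_rel"
    using exterior_ideal_uminus by (fastforce simp: symp_def exterior_rel_def)
  show "transp exterior_rel"
    using exterior_ideal.add by (fastforce simp: transp_def exterior_rel_def)
qed

text \<open>The exterior algebra over \<open>'k\<close> of the free module with basis \<open>'v\<close>.\<close>

quotient_type (overloaded) ('v, 'k) exterior =
  "('v, 'k::comm_ring_1) tensor_algebra" / exterior_rel
  by (rule equivp_exterior_rel)

instantiation exterior :: (type, comm_ring_1) ring_1
begin

lift_definition zero_exterior :: "('a, 'b) exterior" is 0 .
lift_definition one_exterior :: "('a, 'b) exterior" is 1 .

lift_definition plus_exterior :: "('a, 'b) exterior \<Rightarrow> ('a, 'b) exterior \<Rightarrow> ('a, 'b) exterior" is "(+)"
  unfolding exterior_rel_def by (metis exterior_ideal.add add_diff_add)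

lift_definition uminus_exterior :: "('a, 'b) exterior \<Rightarrow> ('a, 'b) exterior" is uminus
  unfolding exterior_rel_def by (metis exterior_ideal_uminus minus_diff_minus)

lift_definition minus_exterior :: "('a, 'b) exterior \<Rightarrow> ('a, 'b) exterior \<Rightarrow> ('a, 'b) exterior" is "(-)"
proof -
  fix s s' t t' :: "('a, 'b) tensor_algebra"
  assume "exterior_rel s s'" "exterior_rel t t'"
  then have "(s - s') - (t - t') \<in> exterior_ideal"
    unfolding exterior_rel_def by (rule exterior_ideal_diff)
  then show "exterior_rel (s - t) (s' - t')"
    unfolding exterior_rel_def by (simp add: algebra_simps)
qed

lift_definition times_exterior :: "('a, 'b) exterior \<Rightarrow> ('a, 'b) exterior \<Rightarrow> ('a, 'b) exterior" is "(*)"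
proof -
  fix s s' t t' :: "('a, 'b) tensor_algebra"
  assume "exterior_rel s s'" "exterior_rel t t'"
  then have "(s - s') * t + s' * (t - t') \<in> exterior_ideal"
    unfolding exterior_rel_def
    by (intro exterior_ideal.add exterior_ideal_mult_left exterior_ideal_mult_right)
  then show "exterior_rel (s * t) (s' * t')"
    unfolding exterior_rel_def by (simp add: algebra_simps)
qed

instance
proof
  have refl: "exterior_rel s t" if "s = t" for s t :: "('a, 'b) tensor_algebra"
    using that by (simp add: exterior_rel_def exterior_ideal.zero)
  fix a b c :: "('a, 'b) exterior"
  show "a + b + c = a + (b + c)" by transfer (rule refl, simp add: add.assoc)
  show "a + b = b + a" by transfer (rule refl, simp add: add.commute)
  show "0 + a = a" by transfer (rule refl, simp)
  show "- a + a = 0" by transfer (rule refl, simp)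
  show "a - b = a + - b" by transfer (rule refl, simp)
  show "a * b * c = a * (b * c)" by transfer (rule refl, simp add: mult.assoc)
  show "(a + b) * c = a * c + b * c" by transfer (rule refl, simp add: distrib_right)
  show "a * (b + c) = a * b + a * c" by transfer (rule refl, simp add: distrib_left)
  show "1 * a = a" by transfer (rule refl, simp)
  show "a * 1 = a" by transfer (rule refl, simp)
  show "(0 :: ('a, 'b) exterior) \<noteq> 1"
  proof transfer
    show "\<not> exterior_rel (0 :: ('a, 'b) tensor_algebra) 1"
      using exterior_ideal_lookup_zero[of "- 1 :: ('a, 'b) tensor_algebra"]
      by (auto simp: exterior_rel_def)
  qed
qed

end

definition ext_scalar :: "'k::comm_ring_1 \<Rightarrow> ('v, 'k) exterior" where
  "ext_scalar c = abs_exterior (Poly_Mapping.single 0 c)"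

definition ext_gen :: "'v \<Rightarrow> ('v, 'k::comm_ring_1) exterior" where
  "ext_gen v = abs_exterior (Poly_Mapping.single (Free [v]) 1)"


section \<open>Polynomial differential forms on matrix space\<close>

text \<open>
  The keys \<^typ>\<open>('n \<times> 'n) \<Rightarrow>\<^sub>0 nat\<close> are the monomials in the variables \<open>x\<^sub>i\<^sub>j\<close>; polynomials in these
  with coefficients in the exterior algebra on the symbols \<open>dx\<^sub>i\<^sub>j\<close> are the tensor product of the
  polynomial ring and the exterior algebra over \<open>'k\<close>.  Monomials are central in the convolution
  product, and \<open>*\<close> is the wedge product.
\<close>

type_synonym ('n, 'k) mat_form = "(('n \<times> 'n) \<Rightarrow>\<^sub>0 nat) \<Rightarrow>\<^sub>0 ('n \<times> 'n, 'k) exterior"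

definition form_scalar :: "'k::comm_ring_1 \<Rightarrow> ('n, 'k) mat_form" where
  "form_scalar c = Poly_Mapping.single 0 (ext_scalar c)"

definition X_mat :: "('n::finite, 'k::comm_ring_1) mat_form ^'n ^'n" where
  "X_mat = (\<chi> i j. Poly_Mapping.single (Poly_Mapping.single (i, j) 1) 1)"

definition dX_mat :: "('n::finite, 'k::comm_ring_1) mat_form ^'n ^'n" where
  "dX_mat = (\<chi> i j. Poly_Mapping.single 0 (ext_gen (i, j)))"

primrec mat_power :: "'a::semiring_1 ^'n ^'n \<Rightarrow> nat \<Rightarrow> 'a ^'n ^'n" where
  "mat_power A 0 = mat 1"
| "mat_power A (Suc l) = A ** mat_power A l"

definition omega :: "nat list \<Rightarrow> ('n::finite, 'k::comm_ring_1) mat_form" where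
  "omega ls = trace (foldr (\<lambda>l M. mat_power X_mat l ** dX_mat ** M) ls (mat 1))"


section \<open>The conjugation action\<close>

text \<open>Fixing the scalars makes a ring homomorphism unital and \<open>'k\<close>-linear.\<close>

definition form_alg_hom ::
  "(('n, 'k::comm_ring_1) mat_form \<Rightarrow> ('n, 'k) mat_form) \<Rightarrow> bool" where
  "form_alg_hom F \<longleftrightarrow>
     (\<forall>a b. F (a + b) = F a + F b) \<and> (\<forall>a b. F (a * b) = F a * F b) \<and>
     (\<forall>c. F (form_scalar c) = form_scalar c)"

definition conj_mat ::
  "'k::field ^'n ^'n \<Rightarrow> ('n::finite, 'k) mat_form ^'n ^'n \<Rightarrow> ('n, 'k) mat_form ^'n ^'n" where
  "conj_mat g A = map_matrix form_scalar g ** A ** map_matrix form_scalar (matrix_inv g)"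

definition is_pullback ::
  "'k::field ^'n ^'n \<Rightarrow> (('n::finite, 'k) mat_form \<Rightarrow> ('n, 'k) mat_form) \<Rightarrow> bool" where
  "is_pullback g F \<longleftrightarrow> form_alg_hom F \<and>
     (\<forall>i j. F (X_mat $ i $ j) = conj_mat g X_mat $ i $ j) \<and>
     (\<forall>i j. F (dX_mat $ i $ j) = conj_mat g dX_mat $ i $ j)"

text \<open>
  Exactly one algebra endomorphism has the prescribed values on the generators \<open>x\<^sub>i\<^sub>j\<close> and
  \<open>dx\<^sub>i\<^sub>j\<close>; see \<open>is_pullback_pullback\<close> and \<open>is_pullback_unique\<close> below.
\<close>

definition pullback :: "'k::field ^'n ^'n \<Rightarrow> ('n::finite, 'k) mat_form \<Rightarrow> ('n, 'k) mat_form" where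
  "pullback g = (THE F. is_pullback g F)"

definition form_subalgebra :: "('n, 'k::comm_ring_1) mat_form set \<Rightarrow> bool" where
  "form_subalgebra S \<longleftrightarrow> (\<forall>c. form_scalar c \<in> S) \<and>
     (\<forall>a\<in>S. \<forall>b\<in>S. a + b \<in> S) \<and> (\<forall>a\<in>S. \<forall>b\<in>S. a * b \<in> S)"

lemma form_alg_homD:
  assumes "form_alg_hom F"
  shows "F (a + b) = F a + F b" "F (a * b) = F a * F b" "F (form_scalar c) = form_scalar c"
  using assms by (auto simp: form_alg_hom_def)

lemma ext_scalar_0 [simp]: "ext_scalar 0 = 0"
  by (simp add: ext_scalar_def zero_exterior.abs_eq)

lemma ext_scalar_1 [simp]: "ext_scalar 1 = 1"
  by (simp add: ext_scalar_def one_exterior.abs_eq)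

lemma ext_scalar_add: "ext_scalar (c + d) = ext_scalar c + ext_scalar d"
  by (simp add: ext_scalar_def plus_exterior.abs_eq single_add)

lemma ext_scalar_mult: "ext_scalar (c * d) = ext_scalar c * ext_scalar d"
  by (simp add: ext_scalar_def times_exterior.abs_eq mult_single)

lemma scalar_commute_tensor:
  "Poly_Mapping.single 0 c * t = t * Poly_Mapping.single 0 c"
  for t :: "('v, 'k::comm_ring_1) tensor_algebra"
  by (induction t rule: poly_mapping_monomial_induct)
     (simp_all add: mult_single mult.commute distrib_left distrib_right)

lemma ext_scalar_commute: "ext_scalar c * a = a * ext_scalar c"
  by (induction a rule: exterior.abs_induct)
     (simp add: ext_scalar_def times_exterior.abs_eq scalar_commute_tensor)

lemma form_scalar_0 [simp]: "form_scalar 0 = 0"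
  by (simp add: form_scalar_def)

lemma form_scalar_1 [simp]: "form_scalar 1 = 1"
  by (simp add: form_scalar_def)

lemma form_scalar_add: "form_scalar (c + d) = form_scalar c + form_scalar d"
  by (simp add: form_scalar_def ext_scalar_add single_add)

lemma form_scalar_mult: "form_scalar (c * d) = form_scalar c * form_scalar d"
  by (simp add: form_scalar_def ext_scalar_mult mult_single)

lemma form_scalar_commute: "form_scalar c * a = a * form_scalar c"
  by (induction a rule: poly_mapping_monomial_induct)
     (simp_all add: form_scalar_def mult_single ext_scalar_commute distrib_left distrib_right)

lemma X_mat_commute: "X_mat $ i $ j * a = a * X_mat $ i $ j"
  by (induction a rule: poly_mapping_monomial_induct)
     (simp_all add: X_mat_def mult_single add.commute distrib_left distrib_right)

lemma conj_mat_nth: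
  "conj_mat g A $ i $ j =
    (\<Sum>l\<in>UNIV. (\<Sum>k\<in>UNIV. form_scalar (g $ i $ k) * A $ k $ l) * form_scalar (matrix_inv g $ l $ j))"
  by (simp add: conj_mat_def matrix_matrix_mult_def)

lemma commute_mult: "x * a = a * x \<Longrightarrow> y * a = a * y \<Longrightarrow> x * y * a = a * (x * y)"
  for a x y :: "'a::semigroup_mult"
  by (metis mult.assoc)

lemma commute_sum: "(\<And>x. f x * a = a * f x) \<Longrightarrow> sum f A * a = a * sum f A"
  for a :: "'a::semiring_0"
  by (simp add: sum_distrib_left sum_distrib_right)

lemma conj_mat_X_commute: "conj_mat g X_mat $ i $ j * a = a * conj_mat g X_mat $ i $ j"
  unfolding conj_mat_nth
  by (intro commute_sum commute_mult form_scalar_commute X_mat_commute)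

lemma form_subalgebra_generators:
  fixes S :: "('n::finite, 'k::comm_ring_1) mat_form set"
  assumes S: "form_subalgebra S" and X: "\<And>i j. X_mat $ i $ j \<in> S" and dX: "\<And>i j. dX_mat $ i $ j \<in> S"
  shows "a \<in> S"
proof -
  have scalar: "form_scalar c \<in> S" for c using S by (simp add: form_subalgebra_def)
  have add: "a \<in> S \<Longrightarrow> b \<in> S \<Longrightarrow> a + b \<in> S" for a b using S by (simp add: form_subalgebra_def)
  have mult: "a \<in> S \<Longrightarrow> b \<in> S \<Longrightarrow> a * b \<in> S" for a b using S by (simp add: form_subalgebra_def)
  have zero: "0 \<in> S" using scalar[of 0] by simp
  have one: "1 \<in> S" using scalar[of 1] by simp
  have mono: "Poly_Mapping.single m 1 \<in> S" for m
  proof (induction m rule: poly_mapping_monomial_induct)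
    case zero
    then show ?case using one by simp
  next
    case (monomial v e)
    show ?case
    proof (induction e)
      case 0
      then show ?case using one by simp
    next
      case (Suc e)
      have "Poly_Mapping.single (Poly_Mapping.single v (Suc e)) 1 =
        (X_mat :: ('n, 'k) mat_form ^'n ^'n) $ fst v $ snd v * Poly_Mapping.single (Poly_Mapping.single v e) 1"
        by (simp add: X_mat_def mult_single single_add[symmetric])
      then show ?case using X mult Suc by simp
    qed
  next
    case (add m m')
    then have "Poly_Mapping.single m 1 * Poly_Mapping.single m' 1 \<in> S" by (rule mult)
    then show ?case by (simp add: mult_single)
  qed
  have word: "Poly_Mapping.single 0 (abs_exterior (Poly_Mapping.single (Free vs) 1)) \<in> S" for vs
  proof (induction vs)
    case Nil
    then show ?case
      using one by (simp add: zero_free_monoid_def[symmetric] one_exterior.abs_eq[symmetric])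
  next
    case (Cons v vs)
    have "Poly_Mapping.single 0 (abs_exterior (Poly_Mapping.single (Free (v # vs)) 1)) =
      (dX_mat :: ('n, 'k) mat_form ^'n ^'n) $ fst v $ snd v * Poly_Mapping.single 0 (abs_exterior (Poly_Mapping.single (Free vs) 1))"
      by (simp add: dX_mat_def mult_single ext_gen_def times_exterior.abs_eq plus_free_monoid_def)
    then show ?case using dX mult Cons by simp
  qed
  have ext: "Poly_Mapping.single 0 (abs_exterior t) \<in> S" for t
  proof (induction t rule: poly_mapping_monomial_induct)
    case zero
    then show ?case using \<open>0 \<in> S\<close> by (simp add: zero_exterior.abs_eq[symmetric])
  next
    case (monomial w c)
    have "Poly_Mapping.single 0 (abs_exterior (Poly_Mapping.single w c)) =
      form_scalar c * Poly_Mapping.single 0 (abs_exterior (Poly_Mapping.single (Free (letters w)) 1))"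
      by (simp add: form_scalar_def ext_scalar_def mult_single times_exterior.abs_eq)
    then show ?case using mult[OF scalar word, of c "letters w"] by simp
  next
    case (add s t)
    then show ?case using \<open>\<And>a b. a \<in> S \<Longrightarrow> b \<in> S \<Longrightarrow> a + b \<in> S\<close>
      by (simp add: plus_exterior.abs_eq[symmetric] single_add)
  qed
  show ?thesis
  proof (induction a rule: poly_mapping_monomial_induct)
    case (monomial m l)
    obtain t where "l = abs_exterior t" by (induction l rule: exterior.abs_induct) blast
    then have "Poly_Mapping.single m l = Poly_Mapping.single m 1 * Poly_Mapping.single 0 (abs_exterior t)"
      by (simp add: mult_single)
    then show ?case using mult[OF mono ext] by simp
  qed (use zero add in auto)
qed

lemma is_pullback_unique:
  assumes F: "is_pullback g F" and G: "is_pullback g G"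
  shows "F = G"
proof
  fix a
  have "form_subalgebra {a. F a = G a}"
    using F G by (auto simp: form_subalgebra_def is_pullback_def form_alg_homD)
  then have "a \<in> {a. F a = G a}"
    by (rule form_subalgebra_generators) (use F G in \<open>auto simp: is_pullback_def\<close>)
  then show "F a = G a" by simp
qed

definition linear_forms :: "('n, 'k::comm_ring_1) mat_form set" where
  "linear_forms = {Poly_Mapping.single 0 (abs_exterior t) | t. tensor_degree_one t}"

lemma linear_forms_zero: "0 \<in> linear_forms"
  unfolding linear_forms_def
  by (auto simp: tensor_degree_one_def zero_exterior.abs_eq[symmetric] intro!: exI[of _ 0])

lemma linear_forms_add:
  assumes "a \<in> linear_forms" "b \<in> linear_forms"
  shows "a + b \<in> linear_forms"
proof -
  obtain s t where st: "a = Poly_Mapping.single 0 (abs_exterior s)" "tensor_degree_one s"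
    "b = Poly_Mapping.single 0 (abs_exterior t)" "tensor_degree_one t"
    using assms by (auto simp: linear_forms_def)
  then have "tensor_degree_one (s + t)"
    using keys_add[of s t] by (auto simp: tensor_degree_one_def)
  moreover have "a + b = Poly_Mapping.single 0 (abs_exterior (s + t))"
    by (simp add: st plus_exterior.abs_eq[symmetric] single_add)
  ultimately show ?thesis by (auto simp: linear_forms_def)
qed

lemma linear_forms_scalar:
  assumes "a \<in> linear_forms"
  shows "form_scalar c * a \<in> linear_forms"
proof -
  obtain t where t: "a = Poly_Mapping.single 0 (abs_exterior t)" "tensor_degree_one t"
    using assms by (auto simp: linear_forms_def)
  then have "tensor_degree_one (Poly_Mapping.single 0 c * t)"
    using keys_mult[of "Poly_Mapping.single 0 c" t]
    by (auto simp: tensor_degree_one_def split: if_splits)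
  moreover have "form_scalar c * a = Poly_Mapping.single 0 (abs_exterior (Poly_Mapping.single 0 c * t))"
    by (simp add: t form_scalar_def ext_scalar_def mult_single times_exterior.abs_eq)
  ultimately show ?thesis by (auto simp: linear_forms_def)
qed

lemma linear_forms_sum: "(\<And>x. x \<in> A \<Longrightarrow> f x \<in> linear_forms) \<Longrightarrow> sum f A \<in> linear_forms"
  by (induction A rule: infinite_finite_induct) (auto intro: linear_forms_zero linear_forms_add)

lemma linear_forms_square:
  assumes "a \<in> linear_forms"
  shows "a * a = 0"
proof -
  obtain t where t: "a = Poly_Mapping.single 0 (abs_exterior t)" "tensor_degree_one t"
    using assms by (auto simp: linear_forms_def)
  have "t * t \<in> exterior_ideal"
    using exterior_ideal.square[OF t(2), of 1 1] by simp
  then have "abs_exterior (t * t) = 0"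
    by (simp add: zero_exterior.abs_eq exterior.abs_eq_iff exterior_rel_def)
  then show ?thesis by (simp add: t mult_single times_exterior.abs_eq)
qed

lemma conj_mat_dX_linear: "conj_mat g dX_mat $ i $ j \<in> linear_forms"
proof -
  have "dX_mat $ k $ l \<in> linear_forms" for k l
    by (auto simp: dX_mat_def linear_forms_def ext_gen_def tensor_degree_one_def
        intro!: exI[of _ "Poly_Mapping.single (Free [(k, l)]) 1"])
  then show ?thesis
    unfolding conj_mat_nth
    by (subst form_scalar_commute[symmetric]) (intro linear_forms_sum linear_forms_scalar)
qed

lemma is_pullback_exists:
  fixes g :: "'k::field ^'n::finite ^'n"
  shows "\<exists>F. is_pullback g F"
proof -
  define P where "P = (\<lambda>(i, j). conj_mat g X_mat $ i $ j)"
  define D where "D = (\<lambda>(i, j). conj_mat g dX_mat $ i $ j)"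
  have P_comm: "P v * a = a * P v" for v a
    by (simp add: P_def conj_mat_X_commute split: prod.splits)
  have D_lin: "D v \<in> linear_forms" for v
    by (simp add: D_def conj_mat_dX_linear split: prod.splits)

  define W where "W = (\<lambda>w. prod_list (map D (letters w)))"
  define E where "E = pm_eval form_scalar W"
  have W_add: "W (u + w) = W u * W w" for u w
    by (simp add: W_def plus_free_monoid_def)
  have E_add: "E (s + t) = E s + E t" for s t
    unfolding E_def by (rule pm_eval_add) (simp_all add: form_scalar_add)
  have E_mult: "E (s * t) = E s * E t" for s t
    unfolding E_def
    by (rule pm_eval_mult[OF form_scalar_0 form_scalar_add form_scalar_mult W_add
          form_scalar_commute[symmetric]])
  have E_single: "E (Poly_Mapping.single w c) = form_scalar c * W w" for w c
    unfolding E_def by (rule pm_eval_single) simp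
  have E_zero: "E 0 = 0" by (simp add: E_def pm_eval_zero)
  have E_lin: "E t \<in> linear_forms" if "tensor_degree_one t" for t
    unfolding E_def pm_eval_def
  proof (intro linear_forms_sum linear_forms_scalar)
    fix w assume "w \<in> Poly_Mapping.keys t"
    then have "length (letters w) = 1" using that by (simp add: tensor_degree_one_def)
    then obtain v where "letters w = [v]" by (auto simp: length_Suc_conv)
    then show "W w \<in> linear_forms" by (simp add: W_def D_lin)
  qed
  have E_ideal: "E t = 0" if "t \<in> exterior_ideal" for t
    using that
    by induction (simp_all add: E_zero E_add E_mult linear_forms_square[OF E_lin])
  have E_rel: "E s = E t" if "exterior_rel s t" for s t
    using E_ideal[of "s - t"] that E_add[of "s - t" t] by (simp add: exterior_rel_def)

  define E' where "E' = (\<lambda>l. E (rep_exterior l))"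
  have E'_abs: "E' (abs_exterior t) = E t" for t
    unfolding E'_def by (rule E_rel)
      (metis Quotient3_exterior Quotient3_def equivp_exterior_rel rep_abs_rsp_left equivp_reflp)
  have E'_add: "E' (a + b) = E' a + E' b" for a b
  proof (induction a rule: exterior.abs_induct)
    case (1 s)
    show ?case by (induction b rule: exterior.abs_induct) (simp add: plus_exterior.abs_eq E'_abs E_add)
  qed
  have E'_mult: "E' (a * b) = E' a * E' b" for a b
  proof (induction a rule: exterior.abs_induct)
    case (1 s)
    show ?case by (induction b rule: exterior.abs_induct) (simp add: times_exterior.abs_eq E'_abs E_mult)
  qed
  have E'_zero: "E' 0 = 0" by (simp add: zero_exterior.abs_eq E'_abs E_zero)
  have E'_scalar: "E' (ext_scalar c) = form_scalar c" for c
    by (simp add: ext_scalar_def E'_abs E_single W_def zero_free_monoid_def)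
  have E'_gen: "E' (ext_gen v) = D v" for v
    by (simp add: ext_gen_def E'_abs E_single W_def)
  have E'_one: "E' 1 = 1" using E'_scalar[of 1] by simp

  obtain vs :: "('n \<times> 'n) list" where vs: "set vs = UNIV" "distinct vs"
    using finite_distinct_list[of "UNIV :: ('n \<times> 'n) set"] by auto
  define M where "M = (\<lambda>m. prod_list (map (\<lambda>v. P v ^ Poly_Mapping.lookup m v) vs))"
  have P_pow_comm: "P v ^ e * a = a * P v ^ e" for v e a
  proof (induction e)
    case (Suc e)
    show ?case unfolding power_Suc by (rule commute_mult[OF P_comm Suc])
  qed simp
  have M_comm: "M m * a = a * M m" for m a
  proof -
    have "prod_list (map (\<lambda>v. P v ^ Poly_Mapping.lookup m v) us) * a =
      a * prod_list (map (\<lambda>v. P v ^ Poly_Mapping.lookup m v) us)" for us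
    proof (induction us)
      case (Cons u us)
      show ?case unfolding list.map prod_list.Cons by (rule commute_mult[OF P_pow_comm Cons])
    qed simp
    then show ?thesis unfolding M_def by this
  qed
  have M_add: "M (m + m') = M m * M m'" for m m'
  proof -
    let ?M = "\<lambda>m us. prod_list (map (\<lambda>v. P v ^ Poly_Mapping.lookup m v) us)"
    have "?M (m + m') us = ?M m us * ?M m' us" for us
    proof (induction us)
      case (Cons u us)
      let ?p = "P u ^ Poly_Mapping.lookup m u" and ?q = "P u ^ Poly_Mapping.lookup m' u"
      have "?M (m + m') (u # us) = ?p * ?q * ?M (m + m') us"
        by (simp only: list.map prod_list.Cons lookup_add power_add)
      also have "\<dots> = ?p * (?q * ?M m us) * ?M m' us"
        by (simp only: Cons mult.assoc)
      also have "\<dots> = ?p * (?M m us * ?q) * ?M m' us"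
        by (simp only: P_pow_comm)
      finally show ?case by (simp add: mult.assoc)
    qed simp
    then show ?thesis by (simp add: M_def)
  qed
  have M_zero: "M 0 = 1" unfolding M_def by (induction vs) simp_all
  have M_var: "M (Poly_Mapping.single v 1) = P v" for v
  proof -
    have "prod_list (map (\<lambda>u. P u ^ Poly_Mapping.lookup (Poly_Mapping.single v 1) u) us) =
      (if v \<in> set us then P v else 1)" if "distinct us" for us
      using that by (induction us) (auto simp: lookup_single when_def)
    then show ?thesis using vs by (simp add: M_def)
  qed

  define F where "F = pm_eval E' M"
  have F_single: "F (Poly_Mapping.single m l) = E' l * M m" for m l
    unfolding F_def by (rule pm_eval_single) (rule E'_zero)
  have "form_alg_hom F"
    unfolding form_alg_hom_def
  proof (intro conjI allI)
    show "F (a + b) = F a + F b" for a b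
      unfolding F_def by (rule pm_eval_add) (simp_all add: E'_zero E'_add)
    show "F (a * b) = F a * F b" for a b
      unfolding F_def by (rule pm_eval_mult[OF E'_zero E'_add E'_mult M_add M_comm])
    show "F (form_scalar c) = form_scalar c" for c
      by (simp add: form_scalar_def[of c, where 'n = 'n] F_single E'_scalar M_zero)
  qed
  moreover have "F (X_mat $ i $ j) = conj_mat g X_mat $ i $ j" for i j
    using M_var[of "(i, j)"] by (simp add: X_mat_def F_single E'_one) (simp add: P_def X_mat_def)
  moreover have "F (dX_mat $ i $ j) = conj_mat g dX_mat $ i $ j" for i j
  proof -
    have "F (dX_mat $ i $ j) = D (i, j)" by (simp add: dX_mat_def F_single E'_gen M_zero)
    then show ?thesis by (simp add: D_def)
  qed
  ultimately show ?thesis by (auto simp: is_pullback_def)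
qed

lemma is_pullback_pullback: "is_pullback g (pullback g)"
  unfolding pullback_def
  using is_pullback_exists is_pullback_unique by (metis theI)

definition invariant_forms :: "('n::finite, 'k::field) mat_form set" where
  "invariant_forms = {\<alpha>. \<forall>g. invertible g \<longrightarrow> pullback g \<alpha> = \<alpha>}"

end

theory Submission
  imports Defs "HOL-Computational_Algebra.Polynomial"
begin

text \<open>
  Contraction with \<open>\<partial>/\<partial>x\<^sub>i\<^sub>j\<close> in the polynomial and in the exterior variables gives operators
  \<open>D\<^sub>a\<close>, one for each generator \<open>z\<^sub>a\<close>, that satisfy a signed Leibniz rule.  By Euler's identity, a
  form that is homogeneous of total degree \<open>m\<close> is \<open>1/m!\<close> times the sum of the words of length \<open>m\<close>
  in the \<open>z\<^sub>a\<close>, weighted with the constant terms of its iterated \<open>D\<^sub>a\<close>-images.  The Leibniz rule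
  also shows that these weights transform as a tensor under conjugation, so the weights of an
  invariant form are the entries of a matrix commuting with \<open>g \<otimes> \<dots> \<otimes> g\<close> for all invertible \<open>g\<close>.

  Such a matrix is a combination of permutation operators.  Indeed it commutes with all matrices
  that are symmetric under simultaneous permutation of the tensor factors, since invertible matrices
  are Zariski dense and tensor powers polarize; and the span of the permutation operators is its own
  double commutant because, as in Maschke's theorem, a projection onto it can be averaged.

  Substituting permutation operators for the weights and contracting indices along the cycles of the
  permutation turns the form into a combination of products of traces of words in \<open>X\<close> and \<open>dX\<close>.
  Up to sign these traces are invariant under rotation of the word, hence generators.
\<close>

section \<open>The commutant of the tensor powers of invertible matrices\<close>

text \<open>A linear projection onto the span of the vectors \<open>v \<sigma>\<close> exists even
  when they are dependent; \<open>c\<close> gives the functionals that read off its coefficients.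
  The induction enlarges the span by one vector at a time.\<close>

lemma generalized_inverse:
  fixes v :: "'i \<Rightarrow> 'x \<Rightarrow> 'k::field"
  assumes "finite S" "finite X"
  shows "\<exists>c. \<forall>\<tau>\<in>S. \<forall>x\<in>X. (\<Sum>\<sigma>\<in>S. (\<Sum>y\<in>X. c \<sigma> y * v \<tau> y) * v \<sigma> x) = v \<tau> x"
  using assms(1)
proof (induction S)
  case (insert s S)
  then obtain c where c: "(\<Sum>\<sigma>\<in>S. (\<Sum>y\<in>X. c \<sigma> y * v \<tau> y) * v \<sigma> x) = v \<tau> x"
    if "\<tau> \<in> S" "x \<in> X" for \<tau> x by blast
  define q where "q \<tau> x = (\<Sum>\<sigma>\<in>S. (\<Sum>y\<in>X. c \<sigma> y * v \<tau> y) * v \<sigma> x)" for \<tau> x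
  have q: "q \<tau> x = v \<tau> x" if "\<tau> \<in> S" "x \<in> X" for \<tau> x using c[OF that] by (simp add: q_def)
  show ?case
  proof (cases "\<forall>x\<in>X. q s x = v s x")
    case True
    have "(\<Sum>\<sigma>\<in>S. (\<Sum>y\<in>X. (c(s := \<lambda>_. 0)) \<sigma> y * v \<tau> y) * v \<sigma> x) = q \<tau> x" for \<tau> x
      unfolding q_def using insert.hyps by (intro sum.cong) auto
    then show ?thesis
      using insert.hyps True q by (intro exI[of _ "c(s := \<lambda>_. 0)"]) auto
  next
    case False
    then obtain z where z: "z \<in> X" "q s z \<noteq> v s z" by blast
    define w where "w = v s z - q s z"
    have w: "w \<noteq> 0" using z by (simp add: w_def)
    \<comment> \<open>As a functional, \<open>\<psi>\<close> sends the old vectors to 0 and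
      \<open>v s\<close> to 1: it evaluates at \<open>z\<close> the residual left by the current
      projection and normalises by \<open>w\<close>.\<close>
    define \<psi> where "\<psi> y = ((if y = z then 1 else 0) - (\<Sum>\<sigma>\<in>S. c \<sigma> y * v \<sigma> z)) / w" for y
    have \<psi>: "(\<Sum>y\<in>X. \<psi> y * v \<tau> y) = (v \<tau> z - q \<tau> z) / w" for \<tau>
    proof -
      have "(\<Sum>y\<in>X. \<psi> y * v \<tau> y) =
        (\<Sum>y\<in>X. (if y = z then v \<tau> y else 0) - (\<Sum>\<sigma>\<in>S. c \<sigma> y * v \<sigma> z * v \<tau> y)) / w"
        unfolding \<psi>_def sum_divide_distrib
        by (intro sum.cong) (auto simp: diff_divide_distrib sum_distrib_right left_diff_distrib)
      also have "(\<Sum>y\<in>X. (if y = z then v \<tau> y else 0) - (\<Sum>\<sigma>\<in>S. c \<sigma> y * v \<sigma> z * v \<tau> y)) =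
        v \<tau> z - (\<Sum>y\<in>X. \<Sum>\<sigma>\<in>S. c \<sigma> y * v \<sigma> z * v \<tau> y)"
        using z(1) assms(2) by (simp add: sum_subtractf sum.delta')
      also have "(\<Sum>y\<in>X. \<Sum>\<sigma>\<in>S. c \<sigma> y * v \<sigma> z * v \<tau> y) = q \<tau> z"
        unfolding q_def by (subst sum.swap) (auto simp: sum_distrib_right sum_distrib_left mult_ac intro!: sum.cong)
      finally show ?thesis .
    qed
    \<comment> \<open>The new projection adds \<open>\<psi>\<close> times the residual
      \<open>v s - q s\<close>. Expanding \<open>q s\<close> in the old vectors corrects each old
      coefficient.\<close>
    define c' where "c' \<sigma> y = (if \<sigma> = s then \<psi> y else c \<sigma> y - (\<Sum>y'\<in>X. c \<sigma> y' * v s y') * \<psi> y)" for \<sigma> y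
    have eq: "(\<Sum>\<sigma>\<in>insert s S. (\<Sum>y\<in>X. c' \<sigma> y * v \<tau> y) * v \<sigma> x) =
      q \<tau> x + (v \<tau> z - q \<tau> z) / w * (v s x - q s x)" for \<tau> x
    proof -
      define f where "f = (v \<tau> z - q \<tau> z) / w"
      have "(\<Sum>y\<in>X. c' \<sigma> y * v \<tau> y) = (\<Sum>y\<in>X. c \<sigma> y * v \<tau> y) - (\<Sum>y\<in>X. c \<sigma> y * v s y) * f"
        if "\<sigma> \<in> S" for \<sigma>
      proof -
        have "(\<Sum>y\<in>X. c' \<sigma> y * v \<tau> y) =
          (\<Sum>y\<in>X. c \<sigma> y * v \<tau> y - (\<Sum>y'\<in>X. c \<sigma> y' * v s y') * (\<psi> y * v \<tau> y))"
          using that insert.hyps by (intro sum.cong) (auto simp: c'_def algebra_simps)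
        then show ?thesis by (simp only: sum_subtractf f_def flip: sum_distrib_left \<psi>)
      qed
      then have "(\<Sum>\<sigma>\<in>S. (\<Sum>y\<in>X. c' \<sigma> y * v \<tau> y) * v \<sigma> x) =
        (\<Sum>\<sigma>\<in>S. (\<Sum>y\<in>X. c \<sigma> y * v \<tau> y) * v \<sigma> x - f * ((\<Sum>y\<in>X. c \<sigma> y * v s y) * v \<sigma> x))"
        by (intro sum.cong refl) (simp add: left_diff_distrib mult.assoc)
      also have "\<dots> = q \<tau> x - f * q s x" by (simp add: q_def sum_subtractf sum_distrib_left)
      finally show ?thesis
        using insert.hyps by (simp add: c'_def \<psi> algebra_simps flip: f_def)
    qed
    have "q \<tau> x + (v \<tau> z - q \<tau> z) / w * (v s x - q s x) = v \<tau> x" if "\<tau> \<in> insert s S" "x \<in> X" for \<tau> x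
      using that q z(1) w by (auto simp: w_def)
    then show ?thesis using eq by (intro exI[of _ c']) auto
  qed
qed simp

section \<open>Multi-indices and permutations of positions\<close>

text \<open>Extensional functions are used so that equality of functions is equality at the
  positions below \<open>m\<close>, and so that reindexing by a permutation of the positions stays
  inside the set.\<close>

definition multi_index :: "nat \<Rightarrow> (nat \<Rightarrow> 'a) set" where
  "multi_index m = {..<m} \<rightarrow>\<^sub>E UNIV"

abbreviation perms :: "nat \<Rightarrow> (nat \<Rightarrow> nat) set" where
  "perms m \<equiv> {\<sigma>. \<sigma> permutes {..<m}}"

lemma finite_multi_index [simp]: "finite (multi_index m :: (nat \<Rightarrow> 'a::finite) set)"
  by (auto simp: multi_index_def intro: finite_PiE)

lemma multi_index_comp:
  assumes "I \<in> multi_index m" "\<sigma> permutes {..<m}"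
  shows "I \<circ> \<sigma> \<in> multi_index m"
  using assms permutes_not_in[OF assms(2)] by (fastforce simp: multi_index_def PiE_def extensional_def)

lemma multi_index_eq_iff:
  assumes "I \<in> multi_index m" "J \<in> multi_index m"
  shows "I = J \<longleftrightarrow> (\<forall>i<m. I i = J i)"
  using PiE_ext[of I "{..<m}" _ J] assms by (auto simp: multi_index_def)

lemma permutes_comp_eq_iff:
  assumes "\<sigma> permutes A"
  shows "I \<circ> \<sigma> = J \<longleftrightarrow> I = J \<circ> inv \<sigma>"
  using assms by (auto simp: o_assoc[symmetric] permutes_inv_o)

lemma prod_multi_index_delta:
  assumes "I \<in> multi_index m" "J \<in> multi_index m"
  shows "(\<Prod>i<m. if I i = J i then 1 else 0) = (if I = J then 1 else (0::'a::comm_semiring_1))"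
proof (cases "I = J")
  case False
  then obtain i where "i < m" "I i \<noteq> J i" using multi_index_eq_iff[OF assms] by blast
  then show ?thesis using False by (auto intro!: prod_zero)
qed simp

text \<open>The product of the first \<open>m\<close> factors has degree at most \<open>m\<close>,
  so the next top coefficient can only come from multiplying by the slope of the last
  factor.\<close>

lemma coeff_prod_linear:
  fixes a b :: "nat \<Rightarrow> 'a::comm_ring_1"
  shows "coeff (\<Prod>i<m. [:a i, b i:]) m = (\<Prod>i<m. b i)"
proof (induction m)
  case (Suc m)
  have "degree (\<Prod>i<m. [:a i, b i:]) \<le> sum (degree \<circ> (\<lambda>i. [:a i, b i:])) {..<m}"
    by (rule degree_prod_sum_le) simp
  also have "\<dots> \<le> of_nat (card {..<m}) * 1" by (rule sum_bounded_above) simp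
  finally have "coeff (\<Prod>i<m. [:a i, b i:]) (Suc m) = 0" by (intro coeff_eq_0) simp
  then show ?case using Suc by (simp add: mult.commute)
qed simp

lemma poly_det: "poly (det A) s = det (\<chi> i j. poly (A $ i $ j) s)"
  by (simp add: det_def poly_sum poly_prod)

section \<open>Tensor powers and matrices commuting with them\<close>

definition tensor_power :: "nat \<Rightarrow> 'k::comm_ring_1 ^'n ^'n \<Rightarrow> (nat \<Rightarrow> 'n) \<Rightarrow> (nat \<Rightarrow> 'n) \<Rightarrow> 'k" where
  "tensor_power m A I J = (\<Prod>i<m. A $ I i $ J i)"

definition commutes_on ::
  "'i set \<Rightarrow> ('i \<Rightarrow> 'i \<Rightarrow> 'k::comm_ring_1) \<Rightarrow> ('i \<Rightarrow> 'i \<Rightarrow> 'k) \<Rightarrow> bool" where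
  "commutes_on W s t \<longleftrightarrow> (\<forall>I\<in>W. \<forall>J\<in>W. (\<Sum>K\<in>W. s I K * t K J) = (\<Sum>K\<in>W. t I K * s K J))"

lemma commutes_on_sum:
  assumes "\<And>x. x \<in> X \<Longrightarrow> commutes_on W t (s x)"
  shows "commutes_on W t (\<lambda>I J. \<Sum>x\<in>X. c x * s x I J)"
  unfolding commutes_on_def
proof (intro ballI)
  fix I J assume IJ: "I \<in> W" "J \<in> W"
  have "(\<Sum>K\<in>W. t I K * (\<Sum>x\<in>X. c x * s x K J)) = (\<Sum>x\<in>X. c x * (\<Sum>K\<in>W. t I K * s x K J))"
    by (simp add: sum_distrib_left mult_ac sum.swap[of _ W])
  also have "\<dots> = (\<Sum>x\<in>X. c x * (\<Sum>K\<in>W. s x I K * t K J))"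
    using assms IJ by (intro sum.cong) (auto simp: commutes_on_def)
  also have "\<dots> = (\<Sum>K\<in>W. (\<Sum>x\<in>X. c x * s x I K) * t K J)"
    by (simp add: sum_distrib_left sum_distrib_right mult_ac sum.swap[of _ W])
  finally show "(\<Sum>K\<in>W. t I K * (\<Sum>x\<in>X. c x * s x K J)) = (\<Sum>K\<in>W. (\<Sum>x\<in>X. c x * s x I K) * t K J)" .
qed

lemma commutes_on_cong:
  assumes "\<And>I J. I \<in> W \<Longrightarrow> J \<in> W \<Longrightarrow> s I J = s' I J" "commutes_on W t s"
  shows "commutes_on W t s'"
  using assms by (simp add: commutes_on_def)

text \<open>
  Invertible matrices are Zariski dense: \<open>1 + sA\<close> is invertible for almost all \<open>s\<close>, and the
  coefficient of \<open>s ^ m\<close> in its tensor power is the tensor power of \<open>A\<close>.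
\<close>

lemma commutes_on_tensor_power:
  fixes t :: "(nat \<Rightarrow> 'n::finite) \<Rightarrow> (nat \<Rightarrow> 'n) \<Rightarrow> 'k::field_char_0"
  assumes "\<And>g. invertible g \<Longrightarrow> commutes_on (multi_index m) t (tensor_power m g)"
  shows "commutes_on (multi_index m) t (tensor_power m A)"
  unfolding commutes_on_def
proof (intro ballI)
  fix I J :: "nat \<Rightarrow> 'n" assume IJ: "I \<in> multi_index m" "J \<in> multi_index m"
  define e where "e i j = [:mat 1 $ i $ j, A $ i $ j:]" for i j
  define p where "p = (\<Sum>K\<in>multi_index m. [:t I K:] * (\<Prod>i<m. e (K i) (J i))) -
    (\<Sum>K\<in>multi_index m. (\<Prod>i<m. e (I i) (K i)) * [:t K J:])"
  define d where "d = det (\<chi> i j. e i j)"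
  define B where "B s = (\<chi> i j. poly (e i j) s)" for s
  \<comment> \<open>Where \<open>B s\<close> is invertible the hypothesis makes \<open>p\<close>
    vanish; elsewhere its determinant \<open>d\<close> vanishes. So \<open>p * d\<close> is zero on
    an infinite field, and \<open>d\<close> is nonzero because its value at 0 is 1.\<close>
  have "poly (p * d) s = 0" for s
  proof (cases "invertible (B s)")
    case True
    then show ?thesis
      using assms[OF True] IJ
      by (simp add: p_def poly_sum poly_prod commutes_on_def tensor_power_def B_def mult.commute)
  next
    case False
    then have "poly d s = 0" by (simp add: invertible_det_nz B_def d_def poly_det)
    then show ?thesis by simp
  qed
  then have "p * d = 0" using poly_all_0_iff_0 by blast
  moreover have "poly d 0 = 1"
  proof -
    have "(\<chi> i j. mat 1 $ i $ j) = (mat 1 :: 'k^'n^'n)" by (simp add: vec_eq_iff)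
    then show ?thesis by (simp add: d_def poly_det e_def)
  qed
  ultimately have "p = 0" by auto
  then have "coeff p m = 0" by simp
  then show "(\<Sum>K\<in>multi_index m. t I K * tensor_power m A K J) =
    (\<Sum>K\<in>multi_index m. tensor_power m A I K * t K J)"
    by (simp add: p_def coeff_sum tensor_power_def e_def coeff_prod_linear mult.commute)
qed

section \<open>Polarization by alternating sums over subsets\<close>

text \<open>When \<open>T\<close> is a proper subset, its even and odd supersets inside
  \<open>U\<close> are equally many and cancel.\<close>

lemma alternating_sum_subsets:
  assumes "finite U" "T \<subseteq> U"
  shows "(\<Sum>S | T \<subseteq> S \<and> S \<subseteq> U. (-1) ^ card S) = (if T = U then (-1) ^ card U else (0::'a::comm_ring_1))"
proof (cases "T = U")
  case True
  then have "{S. T \<subseteq> S \<and> S \<subseteq> U} = {U}" by auto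
  then show ?thesis using True by simp
next
  case False
  have "finite {S. T \<subseteq> S \<and> S \<subseteq> U}" using assms by simp
  moreover have "T \<subset> U" using False assms by auto
  ultimately show ?thesis
    using card_subsupersets_even_odd[of U T] assms False
    by (subst sum_alternating_cancels) (auto simp: conj_ac)
qed

text \<open>A surjective self-map of a finite set is a permutation. The two encodings differ outside
  \<open>{..<m}\<close>, where multi-indices are \<open>undefined\<close> and permutations are the
  identity; hence the restriction.\<close>

lemma sum_multi_index_permutes:
  "(\<Sum>f | f \<in> multi_index m \<and> f ` {..<m} = {..<m}. h f) = (\<Sum>\<sigma>\<in>perms m. h (restrict \<sigma> {..<m}))"
proof (rule sum.reindex_bij_witness[of _ "\<lambda>\<sigma>. restrict \<sigma> {..<m}" "\<lambda>f i. if i < m then f i else i"])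
  fix f :: "nat \<Rightarrow> nat" assume f: "f \<in> {f. f \<in> multi_index m \<and> f ` {..<m} = {..<m}}"
  then show "restrict (\<lambda>i. if i < m then f i else i) {..<m} = f"
    by (auto simp: multi_index_def restrict_def PiE_def extensional_def)
  show "h (restrict (\<lambda>i. if i < m then f i else i) {..<m}) = h f"
    using \<open>restrict (\<lambda>i. if i < m then f i else i) {..<m} = f\<close> by simp
  have "bij_betw f {..<m} {..<m}"
    using f by (auto simp: bij_betw_def intro: eq_card_imp_inj_on)
  then have "bij_betw (\<lambda>i. if i < m then f i else i) {..<m} {..<m}"
    by (rule bij_betw_cong[THEN iffD1, rotated]) simp
  then show "(\<lambda>i. if i < m then f i else i) \<in> perms m"
    unfolding mem_Collect_eq by (rule bij_imp_permutes) simp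
next
  fix \<sigma> assume \<sigma>: "\<sigma> \<in> perms m"
  then show "(\<lambda>i. if i < m then restrict \<sigma> {..<m} i else i) = \<sigma>"
    by (auto simp: permutes_not_in)
  show "restrict \<sigma> {..<m} \<in> {f. f \<in> multi_index m \<and> f ` {..<m} = {..<m}}"
    using \<sigma> by (auto simp: multi_index_def permutes_image)
qed

text \<open>Ryser's formula for the permanent. Expanding the product of sums yields all maps
  \<open>f\<close> into \<open>S\<close>; summing the signs over all \<open>S\<close> that contain
  the image of \<open>f\<close> leaves only the surjective \<open>f\<close>.\<close>

lemma ryser_formula:
  fixes a :: "nat \<Rightarrow> nat \<Rightarrow> 'a::comm_ring_1"
  shows "(\<Sum>S\<in>Pow {..<m}. (-1) ^ card S * (\<Prod>i<m. \<Sum>j\<in>S. a i j)) =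
    (-1) ^ m * (\<Sum>\<sigma>\<in>perms m. \<Prod>i<m. a i (\<sigma> i))"
proof -
  let ?F = "{..<m} \<rightarrow>\<^sub>E {..<m}"
  let ?p = "\<lambda>f. \<Prod>i<m. a i (f i)"
  have "(\<Prod>i<m. \<Sum>j\<in>S. a i j) = (\<Sum>f\<in>?F. if f ` {..<m} \<subseteq> S then ?p f else 0)"
    if "S \<subseteq> {..<m}" for S
  proof -
    have "(\<Prod>i<m. \<Sum>j\<in>S. a i j) = (\<Sum>f\<in>{..<m} \<rightarrow>\<^sub>E S. ?p f)"
      using that by (subst prod_sum_PiE) (auto intro: finite_subset)
    also have "{..<m} \<rightarrow>\<^sub>E S = {f \<in> ?F. f ` {..<m} \<subseteq> S}"
      using that by (auto simp: PiE_def)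
    also have "sum ?p \<dots> = (\<Sum>f\<in>?F. if f ` {..<m} \<subseteq> S then ?p f else 0)"
      by (rule sum.inter_filter) (simp add: finite_PiE)
    finally show ?thesis .
  qed
  then have "(\<Sum>S\<in>Pow {..<m}. (-1) ^ card S * (\<Prod>i<m. \<Sum>j\<in>S. a i j)) =
    (\<Sum>S\<in>Pow {..<m}. \<Sum>f\<in>?F. if f ` {..<m} \<subseteq> S then (-1) ^ card S * ?p f else 0)"
    by (intro sum.cong) (auto simp: sum_distrib_left intro!: sum.cong)
  also have "\<dots> = (\<Sum>f\<in>?F. \<Sum>S\<in>Pow {..<m}. if f ` {..<m} \<subseteq> S then (-1) ^ card S * ?p f else 0)"
    by (rule sum.swap)
  also have "\<dots> = (\<Sum>f\<in>?F. if f ` {..<m} = {..<m} then (-1) ^ m * ?p f else 0)"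
  proof (intro sum.cong refl)
    fix f assume "f \<in> ?F"
    then have f: "f ` {..<m} \<subseteq> {..<m}" by auto
    have "(\<Sum>S\<in>Pow {..<m}. if f ` {..<m} \<subseteq> S then (-1) ^ card S * ?p f else 0) =
      (\<Sum>S\<in>{S \<in> Pow {..<m}. f ` {..<m} \<subseteq> S}. (-1) ^ card S * ?p f)"
      by (rule sum.inter_filter[symmetric]) simp
    also have "\<dots> = (\<Sum>S | f ` {..<m} \<subseteq> S \<and> S \<subseteq> {..<m}. (-1) ^ card S) * ?p f"
      by (simp add: sum_distrib_right conj_commute)
    also have "\<dots> = (if f ` {..<m} = {..<m} then (-1) ^ m * ?p f else 0)"
      by (subst alternating_sum_subsets[OF _ f]) auto
    finally show "(\<Sum>S\<in>Pow {..<m}. if f ` {..<m} \<subseteq> S then (-1) ^ card S * ?p f else 0) = \<dots>" .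
  qed
  also have "\<dots> = (\<Sum>f | f \<in> ?F \<and> f ` {..<m} = {..<m}. (-1) ^ m * ?p f)"
    by (rule sum.inter_filter[symmetric]) (simp add: finite_PiE)
  also have "{f. f \<in> ?F \<and> f ` {..<m} = {..<m}} = {f. f \<in> multi_index m \<and> f ` {..<m} = {..<m}}"
    by (auto simp: multi_index_def PiE_def)
  also have "(\<Sum>f\<in>\<dots>. (-1) ^ m * ?p f) = (\<Sum>\<sigma>\<in>perms m. (-1) ^ m * (\<Prod>i<m. a i (\<sigma> i)))"
    by (subst sum_multi_index_permutes) simp
  finally show ?thesis by (simp add: sum_distrib_left)
qed

text \<open>The second matrix is the orbit sum of a matrix unit under simultaneous permutation of
  the tensor factors. Ryser's formula writes it as an alternating sum of tensor powers.\<close>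

lemma commutes_on_symmetrized_unit:
  fixes t :: "(nat \<Rightarrow> 'n::finite) \<Rightarrow> (nat \<Rightarrow> 'n) \<Rightarrow> 'k::field_char_0"
  assumes "\<And>g. invertible g \<Longrightarrow> commutes_on (multi_index m) t (tensor_power m g)"
    and KL: "K \<in> multi_index m" "L \<in> multi_index m"
  shows "commutes_on (multi_index m) t
    (\<lambda>I J. \<Sum>\<sigma>\<in>perms m. if I = K \<circ> \<sigma> \<and> J = L \<circ> \<sigma> then 1 else 0)"
proof (rule commutes_on_cong)
  \<comment> \<open>\<open>?A S\<close> is the sum of the elementary matrices with row
    \<open>K j\<close> and column \<open>L j\<close> for \<open>j\<close> in \<open>S\<close>. The
    factor \<open>(-1) ^ m\<close> put into the combination below cancels the one in Ryser's
    formula.\<close>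
  let ?A = "\<lambda>S. \<chi> k l. \<Sum>j\<in>S. if k = K j \<and> l = L j then 1 else (0::'k)"
  show "commutes_on (multi_index m) t
    (\<lambda>I J. \<Sum>S\<in>Pow {..<m}. ((-1) ^ m * (-1) ^ card S) * tensor_power m (?A S) I J)"
    by (rule commutes_on_sum, rule commutes_on_tensor_power[OF assms(1)])
  fix I J :: "nat \<Rightarrow> 'n" assume IJ: "I \<in> multi_index m" "J \<in> multi_index m"
  have "(\<Sum>S\<in>Pow {..<m}. ((-1) ^ m * (-1) ^ card S) * tensor_power m (?A S) I J) =
    (-1) ^ m * (\<Sum>S\<in>Pow {..<m}. (-1) ^ card S * (\<Prod>i<m. \<Sum>j\<in>S. if I i = K j \<and> J i = L j then 1 else 0))"
    by (simp add: tensor_power_def sum_distrib_left mult.assoc)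
  also have "\<dots> = (\<Sum>\<sigma>\<in>perms m. \<Prod>i<m. if I i = K (\<sigma> i) \<and> J i = L (\<sigma> i) then 1 else 0)"
    by (subst ryser_formula) (simp flip: mult.assoc power_add mult_2)
  also have "\<dots> = (\<Sum>\<sigma>\<in>perms m. if I = K \<circ> \<sigma> \<and> J = L \<circ> \<sigma> then 1 else 0)"
  proof (intro sum.cong refl)
    fix \<sigma> assume "\<sigma> \<in> perms m"
    then have "K \<circ> \<sigma> \<in> multi_index m" "L \<circ> \<sigma> \<in> multi_index m"
      using KL by (auto intro: multi_index_comp)
    note eq = prod_multi_index_delta[OF IJ(1) this(1), where 'a = 'k]
      prod_multi_index_delta[OF IJ(2) this(2), where 'a = 'k]
    have "(\<Prod>i<m. if I i = K (\<sigma> i) \<and> J i = L (\<sigma> i) then 1 else 0 :: 'k) =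
      (\<Prod>i<m. (if I i = (K \<circ> \<sigma>) i then 1 else 0) * (if J i = (L \<circ> \<sigma>) i then 1 else 0))"
      by (intro prod.cong) auto
    then show "(\<Prod>i<m. if I i = K (\<sigma> i) \<and> J i = L (\<sigma> i) then 1 else 0 :: 'k) =
      (if I = K \<circ> \<sigma> \<and> J = L \<circ> \<sigma> then 1 else 0)"
      unfolding prod.distrib eq by simp
  qed
  finally show "(\<Sum>S\<in>Pow {..<m}. ((-1) ^ m * (-1) ^ card S) * tensor_power m (?A S) I J) =
    (\<Sum>\<sigma>\<in>perms m. if I = K \<circ> \<sigma> \<and> J = L \<circ> \<sigma> then 1 else 0)" .
qed

text \<open>Such a matrix is constant on orbits of index pairs, so it is a combination of
  symmetrized matrix units weighted by its own entries. Each entry is then counted once for every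
  permutation, hence the division by \<open>fact m\<close>.\<close>

lemma commutes_on_symmetric:
  fixes t :: "(nat \<Rightarrow> 'n::finite) \<Rightarrow> (nat \<Rightarrow> 'n) \<Rightarrow> 'k::field_char_0"
  assumes "\<And>g. invertible g \<Longrightarrow> commutes_on (multi_index m) t (tensor_power m g)"
    and sym: "\<And>\<sigma> I J. \<sigma> permutes {..<m} \<Longrightarrow> I \<in> multi_index m \<Longrightarrow> J \<in> multi_index m \<Longrightarrow>
      B (I \<circ> \<sigma>) (J \<circ> \<sigma>) = B I J"
  shows "commutes_on (multi_index m) t B"
proof (rule commutes_on_cong)
  let ?W = "multi_index m :: (nat \<Rightarrow> 'n) set"
  let ?U = "\<lambda>(K, L) I J. \<Sum>\<sigma>\<in>perms m. if I = K \<circ> \<sigma> \<and> J = L \<circ> \<sigma> then 1 else 0 :: 'k"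
  show "commutes_on ?W t (\<lambda>I J. \<Sum>x\<in>?W \<times> ?W. (B (fst x) (snd x) / fact m) * ?U x I J)"
    by (intro commutes_on_sum) (auto intro!: commutes_on_symmetrized_unit assms(1))
  fix I J assume IJ: "I \<in> ?W" "J \<in> ?W"
  have "(\<Sum>x\<in>?W \<times> ?W. (B (fst x) (snd x) / fact m) * ?U x I J) =
    (\<Sum>\<sigma>\<in>perms m. \<Sum>x\<in>?W \<times> ?W. if I = fst x \<circ> \<sigma> \<and> J = snd x \<circ> \<sigma> then B (fst x) (snd x) / fact m else 0)"
    by (subst sum.swap) (auto intro!: sum.cong simp: sum_distrib_left sum_divide_distrib)
  also have "\<dots> = (\<Sum>\<sigma>\<in>perms m. B I J / fact m)"
  proof (intro sum.cong refl)
    fix \<sigma> assume "\<sigma> \<in> perms m"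
    then have \<sigma>: "\<sigma> permutes {..<m}" "inv \<sigma> permutes {..<m}" by (auto intro: permutes_inv)
    \<comment> \<open>For a given \<sigma> exactly one pair \<open>x\<close> contributes, obtained
      by undoing \<sigma> in both indices.\<close>
    have "(\<Sum>x\<in>?W \<times> ?W. if I = fst x \<circ> \<sigma> \<and> J = snd x \<circ> \<sigma> then B (fst x) (snd x) / fact m else 0) =
      (\<Sum>x\<in>?W \<times> ?W. if x = (I \<circ> inv \<sigma>, J \<circ> inv \<sigma>) then B (fst x) (snd x) / fact m else 0)"
      using permutes_comp_eq_iff[OF \<sigma>(1), of _ I] permutes_comp_eq_iff[OF \<sigma>(1), of _ J]
      by (intro sum.cong) (simp_all add: eq_commute[of I] eq_commute[of J] prod_eq_iff)
    also have "\<dots> = B (I \<circ> inv \<sigma>) (J \<circ> inv \<sigma>) / fact m"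
      using IJ \<sigma> by (subst sum.delta) (auto intro: multi_index_comp)
    finally show "(\<Sum>x\<in>?W \<times> ?W. if I = fst x \<circ> \<sigma> \<and> J = snd x \<circ> \<sigma> then B (fst x) (snd x) / fact m else 0) =
      B I J / fact m"
      using sym[OF \<sigma>(2) IJ] by simp
  qed
  also have "\<dots> = B I J" by (simp add: card_permutations[OF refl])
  finally show "(\<Sum>x\<in>?W \<times> ?W. (B (fst x) (snd x) / fact m) * ?U x I J) = B I J" .
qed

section \<open>The commutant as a span of permutation operators\<close>

text \<open>An averaged projection Q onto the permutation operators fixes the identity, and for
  fixed column indices its kernel commutes with \<open>t\<close>. Hence t = t Q(1) = Q(t), which
  lies in the span. The double sum arises because averaging composes each \<sigma> with an inverse
  \<rho>.\<close>

lemma commutant_of_tensor_powers: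
  fixes t :: "(nat \<Rightarrow> 'n::finite) \<Rightarrow> (nat \<Rightarrow> 'n) \<Rightarrow> 'k::field_char_0"
  assumes "\<And>g. invertible g \<Longrightarrow> commutes_on (multi_index m) t (tensor_power m g)"
  obtains c where "\<And>I J. I \<in> multi_index m \<Longrightarrow> J \<in> multi_index m \<Longrightarrow>
    t I J = (\<Sum>\<rho>\<in>perms m. \<Sum>\<sigma>\<in>perms m. if I = J \<circ> \<sigma> \<circ> inv \<rho> then c \<rho> \<sigma> else 0)"
proof -
  let ?W = "multi_index m :: (nat \<Rightarrow> 'n) set"
  \<comment> \<open>\<open>v \<sigma>\<close> is the permutation operator of \<sigma>, flattened to
    a vector indexed by pairs of multi-indices.\<close>
  define v where "v \<sigma> x = (if fst x = snd x \<circ> \<sigma> then 1 else 0 :: 'k)" for \<sigma> :: "nat \<Rightarrow> nat" and x :: "(nat \<Rightarrow> 'n) \<times> (nat \<Rightarrow> 'n)"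
  obtain c where c: "(\<Sum>\<sigma>\<in>perms m. (\<Sum>y\<in>?W \<times> ?W. c \<sigma> y * v \<tau> y) * v \<sigma> x) = v \<tau> x"
    if "\<tau> \<in> perms m" "x \<in> ?W \<times> ?W" for \<tau> x
    using generalized_inverse[of "perms m" "?W \<times> ?W" v] by (auto simp: finite_permutations)
  \<comment> \<open>\<open>q\<close> is the kernel of a projection acting on matrices: it sends a
    matrix u to the one whose entry at \<open>I\<close>, \<open>J\<close> is the sum of
    \<open>q I J K L\<close> times u at \<open>K\<close>, \<open>L\<close>.\<close>
  define q where "q I J K L = (\<Sum>\<sigma>\<in>perms m. c \<sigma> (K, L) * v \<sigma> (I, J))" for I J K L
  \<comment> \<open>Averaging over permutations of the rows makes the matrix in \<open>I\<close> and
    \<open>K\<close>, for fixed \<open>J\<close> and \<open>L\<close>, symmetric under simultaneous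
    permutation of positions.\<close>
  define Q where "Q I J K L = (\<Sum>\<rho>\<in>perms m. q (I \<circ> \<rho>) J (K \<circ> \<rho>) L) / fact m" for I J K L
  have q_id: "(\<Sum>L\<in>?W. q I J (L \<circ> \<tau>) L) = v \<tau> (I, J)" if "\<tau> \<in> perms m" "I \<in> ?W" "J \<in> ?W" for I J \<tau>
  proof -
    have "(\<Sum>L\<in>?W. q I J (L \<circ> \<tau>) L) = (\<Sum>\<sigma>\<in>perms m. (\<Sum>L\<in>?W. c \<sigma> (L \<circ> \<tau>, L)) * v \<sigma> (I, J))"
      by (simp add: q_def sum_distrib_right sum.swap[of _ ?W])
    also have "\<dots> = (\<Sum>\<sigma>\<in>perms m. (\<Sum>y\<in>?W \<times> ?W. c \<sigma> y * v \<tau> y) * v \<sigma> (I, J))"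
    proof (intro sum.cong refl arg_cong2[where f = "(*)"])
      fix \<sigma>
      have "(\<Sum>y\<in>?W \<times> ?W. c \<sigma> y * v \<tau> y) = (\<Sum>L\<in>?W. \<Sum>K\<in>?W. c \<sigma> (K, L) * v \<tau> (K, L))"
        by (subst sum.swap) (simp add: sum.cartesian_product)
      also have "\<dots> = (\<Sum>L\<in>?W. \<Sum>K\<in>?W. if K = L \<circ> \<tau> then c \<sigma> (K, L) else 0)"
        by (intro sum.cong) (auto simp: v_def)
      also have "\<dots> = (\<Sum>L\<in>?W. c \<sigma> (L \<circ> \<tau>, L))"
        using that by (intro sum.cong refl, subst sum.delta) (auto intro: multi_index_comp)
      finally show "(\<Sum>L\<in>?W. c \<sigma> (L \<circ> \<tau>, L)) = (\<Sum>y\<in>?W \<times> ?W. c \<sigma> y * v \<tau> y)" by simp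
    qed
    also have "\<dots> = v \<tau> (I, J)" using that by (intro c) auto
    finally show ?thesis .
  qed
  have Q_id: "(\<Sum>L\<in>?W. Q I J L L) = (if I = J then 1 else 0)" if "I \<in> ?W" "J \<in> ?W" for I J
  proof -
    have "(\<Sum>L\<in>?W. Q I J L L) = (\<Sum>\<rho>\<in>perms m. \<Sum>L\<in>?W. q (I \<circ> \<rho>) J (L \<circ> \<rho>) L) / fact m"
      unfolding Q_def sum_divide_distrib[symmetric] by (subst sum.swap) simp
    also have "(\<Sum>\<rho>\<in>perms m. \<Sum>L\<in>?W. q (I \<circ> \<rho>) J (L \<circ> \<rho>) L) = (\<Sum>\<rho>\<in>perms m. if I = J then 1 else 0)"
    proof (intro sum.cong refl)
      \<comment> \<open>Permuting the rows of the identity by \<rho> gives the permutation operator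
        of \<rho>, which \<open>q\<close> reproduces; permuting back gives the identity.\<close>
      fix \<rho> assume \<rho>: "\<rho> \<in> perms m"
      then have "I \<circ> \<rho> = J \<circ> \<rho> \<longleftrightarrow> I = J"
        using permutes_comp_eq_iff[of \<rho> "{..<m}" I "J \<circ> \<rho>"]
        by (auto simp: o_assoc[symmetric] permutes_inv_o)
      then show "(\<Sum>L\<in>?W. q (I \<circ> \<rho>) J (L \<circ> \<rho>) L) = (if I = J then 1 else 0)"
        using that \<rho> by (subst q_id) (auto intro: multi_index_comp simp: v_def)
    qed
    finally show ?thesis by (simp add: card_permutations[OF refl])
  qed
  have Q_sym: "Q (I \<circ> \<tau>) J (K \<circ> \<tau>) L = Q I J K L" if "\<tau> permutes {..<m}" for I J K L \<tau>
    unfolding Q_def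
    unfolding setum_permutations_compose_left[OF that, of "\<lambda>\<rho>. q (I \<circ> \<rho>) J (K \<circ> \<rho>) L"]
    by (simp only: o_assoc)
  have t_eq: "t I J = (\<Sum>L\<in>?W. \<Sum>K\<in>?W. Q I J K L * t K L)" if IJ: "I \<in> ?W" "J \<in> ?W" for I J
  proof -
    have "t I J = (\<Sum>K\<in>?W. if K = J then t I K else 0)" using IJ by (subst sum.delta) auto
    also have "\<dots> = (\<Sum>K\<in>?W. t I K * (\<Sum>L\<in>?W. Q K J L L))"
      using IJ by (intro sum.cong) (auto simp: Q_id)
    also have "\<dots> = (\<Sum>L\<in>?W. \<Sum>K\<in>?W. t I K * Q K J L L)"
      unfolding sum_distrib_left by (rule sum.swap)
    also have "\<dots> = (\<Sum>L\<in>?W. \<Sum>K\<in>?W. Q I J K L * t K L)"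
    proof (rule sum.cong[OF refl])
      fix L assume "L \<in> ?W"
      moreover have "commutes_on ?W t (\<lambda>I K. Q I J K L)"
        using assms Q_sym by (rule commutes_on_symmetric)
      ultimately show "(\<Sum>K\<in>?W. t I K * Q K J L L) = (\<Sum>K\<in>?W. Q I J K L * t K L)"
        using IJ by (auto simp: commutes_on_def)
    qed
    finally show ?thesis .
  qed
  define d where "d \<rho> \<sigma> = (\<Sum>L\<in>?W. \<Sum>K\<in>?W. c \<sigma> (K \<circ> \<rho>, L) * t K L) / fact m" for \<rho> \<sigma>
  have "t I J = (\<Sum>\<rho>\<in>perms m. \<Sum>\<sigma>\<in>perms m. if I = J \<circ> \<sigma> \<circ> inv \<rho> then d \<rho> \<sigma> else 0)"
    if IJ: "I \<in> ?W" "J \<in> ?W" for I J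
  proof -
    have "t I J = (\<Sum>L\<in>?W. \<Sum>K\<in>?W. \<Sum>\<rho>\<in>perms m. \<Sum>\<sigma>\<in>perms m.
      v \<sigma> (I \<circ> \<rho>, J) * (c \<sigma> (K \<circ> \<rho>, L) * t K L / fact m))"
      unfolding t_eq[OF IJ] Q_def q_def
      by (simp add: sum_distrib_left sum_distrib_right sum_divide_distrib mult_ac)
    also have "\<dots> = (\<Sum>\<rho>\<in>perms m. \<Sum>\<sigma>\<in>perms m. v \<sigma> (I \<circ> \<rho>, J) * d \<rho> \<sigma>)"
      unfolding d_def sum_divide_distrib sum_distrib_left
      by (simp only: sum.swap[of _ "perms m" ?W])
    also have "\<dots> = (\<Sum>\<rho>\<in>perms m. \<Sum>\<sigma>\<in>perms m. if I = J \<circ> \<sigma> \<circ> inv \<rho> then d \<rho> \<sigma> else 0)"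
      by (intro sum.cong refl) (simp add: v_def permutes_comp_eq_iff)
    finally show ?thesis .
  qed
  then show thesis by (rule that)
qed

section \<open>Derivations of the algebra of forms\<close>

text \<open>The interior product with the functional dual to \<open>v\<close>: every occurrence of
  \<open>v\<close> is deleted in turn, with a sign counting the letters before it.\<close>

primrec word_contract :: "'v \<Rightarrow> 'v list \<Rightarrow> ('v, 'k::comm_ring_1) tensor_algebra" where
  "word_contract v [] = 0"
| "word_contract v (u # us) = (if u = v then Poly_Mapping.single (Free us) 1 else 0) -
    Poly_Mapping.single (Free [u]) 1 * word_contract v us"

definition tensor_contract ::
  "'v \<Rightarrow> ('v, 'k::comm_ring_1) tensor_algebra \<Rightarrow> ('v, 'k) tensor_algebra" where
  "tensor_contract v = pm_eval (Poly_Mapping.single 0) (\<lambda>w. word_contract v (letters w))"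

lemma tensor_contract_zero [simp]: "tensor_contract v 0 = 0"
  by (simp add: tensor_contract_def pm_eval_zero)

lemma tensor_contract_add: "tensor_contract v (s + t) = tensor_contract v s + tensor_contract v t"
  by (simp add: tensor_contract_def pm_eval_add single_add)

lemma tensor_contract_diff: "tensor_contract v (s - t) = tensor_contract v s - tensor_contract v t"
  using tensor_contract_add[of v "s - t" t] by simp

lemma tensor_contract_single:
  "tensor_contract v (Poly_Mapping.single w c) = Poly_Mapping.single 0 c * word_contract v (letters w)"
  by (simp add: tensor_contract_def pm_eval_single)

lemma tensor_contract_scalar:
  "tensor_contract v (Poly_Mapping.single 0 c * t) = Poly_Mapping.single 0 c * tensor_contract v t"
  by (induction t rule: poly_mapping_monomial_induct)
    (simp_all add: tensor_contract_single tensor_contract_add mult_single distrib_left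
      flip: mult.assoc)

lemma tensor_contract_letter:
  "tensor_contract v (Poly_Mapping.single (Free [u]) c * t) =
    Poly_Mapping.single 0 (if u = v then c else 0) * t - Poly_Mapping.single (Free [u]) c * tensor_contract v t"
proof (induction t rule: poly_mapping_monomial_induct)
  case (monomial w d)
  have "Poly_Mapping.single 0 (c * d) * (Poly_Mapping.single (Free [u]) 1 * s) =
    Poly_Mapping.single (Free [u]) c * (Poly_Mapping.single 0 d * s)" for s :: "('a, 'b) tensor_algebra"
    by (simp add: mult_single flip: mult.assoc)
  then show ?case
    by (simp add: tensor_contract_single mult_single plus_free_monoid_def right_diff_distrib)
qed (simp_all add: tensor_contract_add distrib_left)

lemma sum_monomials: "(\<Sum>k\<in>Poly_Mapping.keys f. Poly_Mapping.single k (Poly_Mapping.lookup f k)) = f"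
  by (rule poly_mapping_eqI) (auto simp: lookup_sum lookup_single when_def in_keys_iff)

text \<open>The signed Leibniz rule extends from one letter to linear combinations of letters; the
  scalar is the coefficient of \<open>v\<close> in \<open>x\<close>.\<close>

lemma tensor_contract_degree_one:
  assumes "tensor_degree_one x"
  shows "\<exists>c. \<forall>t. tensor_contract v (x * t) = Poly_Mapping.single 0 c * t - x * tensor_contract v t"
proof -
  have "\<exists>c. \<forall>t. tensor_contract v ((\<Sum>k\<in>A. Poly_Mapping.single k (f k)) * t) =
      Poly_Mapping.single 0 c * t - (\<Sum>k\<in>A. Poly_Mapping.single k (f k)) * tensor_contract v t"
    if "finite A" "\<forall>w\<in>A. length (letters w) = 1" for A and f :: "'a free_monoid \<Rightarrow> 'b"
    using that
  proof (induction A)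
    case empty
    show ?case by (intro exI[of _ 0]) simp
  next
    case (insert w A)
    then obtain c where c: "tensor_contract v ((\<Sum>k\<in>A. Poly_Mapping.single k (f k)) * t) =
      Poly_Mapping.single 0 c * t - (\<Sum>k\<in>A. Poly_Mapping.single k (f k)) * tensor_contract v t" for t
      by auto
    obtain u where "letters w = [u]" using insert.prems by (auto simp: length_Suc_conv)
    then have w: "w = Free [u]" by (metis free_monoid.collapse)
    show ?case
      using insert.hyps
      by (intro exI[of _ "(if u = v then f w else 0) + c"])
        (simp add: distrib_right tensor_contract_add c w tensor_contract_letter single_add)
  qed
  from this[of "Poly_Mapping.keys x" "Poly_Mapping.lookup x"] show ?thesis
    using assms by (simp add: tensor_degree_one_def sum_monomials)
qed

text \<open>In the contraction of x x b the terms c x b and x c b cancel because scalars are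
  central, and what remains is x x times the contraction of b. Left factors are stripped letter by
  letter. Hence contraction descends to the exterior algebra.\<close>

lemma exterior_ideal_contract:
  assumes "t \<in> exterior_ideal"
  shows "tensor_contract v t \<in> exterior_ideal"
  using assms
proof induction
  case (square x a b)
  have left: "tensor_contract v (a * s) \<in> exterior_ideal"
    if s: "s \<in> exterior_ideal" "tensor_contract v s \<in> exterior_ideal" for s
  proof (induction a rule: poly_mapping_monomial_induct)
    case (monomial w c)
    have "tensor_contract v (Poly_Mapping.single (Free us) 1 * s) \<in> exterior_ideal" for us
    proof (induction us)
      case Nil
      then show ?case using s by (simp flip: zero_free_monoid_def)
    next
      case (Cons u us)
      have "Poly_Mapping.single (Free (u # us)) 1 * s =
        Poly_Mapping.single (Free [u]) 1 * (Poly_Mapping.single (Free us) 1 * s)"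
        by (simp add: mult_single plus_free_monoid_def flip: mult.assoc)
      then show ?case
        using s Cons
        by (simp add: tensor_contract_letter exterior_ideal_diff exterior_ideal_mult_left exterior_ideal.zero)
    qed
    from exterior_ideal_mult_left[OF this, of "Poly_Mapping.single 0 c" "letters w"]
    show ?case
      by (simp add: mult_single flip: tensor_contract_scalar mult.assoc)
  qed (simp_all add: exterior_ideal.zero exterior_ideal.add distrib_right tensor_contract_add)
  obtain c where c: "tensor_contract v (x * t) = Poly_Mapping.single 0 c * t - x * tensor_contract v t" for t
    using tensor_contract_degree_one[OF square] by blast
  have "tensor_contract v (x * (x * b)) =
    Poly_Mapping.single 0 c * (x * b) - x * (Poly_Mapping.single 0 c * b - x * tensor_contract v b)"
    by (simp add: c)
  also have "\<dots> = 1 * (x * x) * tensor_contract v b"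
    by (simp add: right_diff_distrib scalar_commute_tensor[of c x] flip: mult.assoc)
  finally have "tensor_contract v (x * (x * b)) \<in> exterior_ideal"
    using exterior_ideal.square[OF square, of 1] by simp
  moreover have "x * (x * b) \<in> exterior_ideal"
    using exterior_ideal.square[OF square, of 1 b] by (simp add: mult.assoc)
  ultimately show ?case using left by (simp add: mult.assoc)
qed (simp_all add: exterior_ideal.zero exterior_ideal.add tensor_contract_add)

lift_definition ext_contract :: "'v \<Rightarrow> ('v, 'k::comm_ring_1) exterior \<Rightarrow> ('v, 'k) exterior"
  is tensor_contract
  using exterior_ideal_contract by (fastforce simp: exterior_rel_def simp flip: tensor_contract_diff)

lift_definition ext_const :: "('v, 'k::comm_ring_1) exterior \<Rightarrow> 'k" is "\<lambda>t. Poly_Mapping.lookup t 0"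
  using exterior_ideal_lookup_zero by (fastforce simp: exterior_rel_def lookup_minus)

lemma exterior_cases: obtains t where "a = abs_exterior t"
  by (induction a rule: exterior.abs_induct) blast

lemma ext_contract_add: "ext_contract v (a + b) = ext_contract v a + ext_contract v b"
  by (cases a rule: exterior_cases; cases b rule: exterior_cases)
    (simp add: plus_exterior.abs_eq ext_contract.abs_eq tensor_contract_add)

lemma ext_contract_zero [simp]: "ext_contract v 0 = 0"
  by (simp add: zero_exterior.abs_eq ext_contract.abs_eq)

lemma ext_contract_scalar: "ext_contract v (ext_scalar c * a) = ext_scalar c * ext_contract v a"
  by (cases a rule: exterior_cases)
    (simp add: ext_scalar_def times_exterior.abs_eq ext_contract.abs_eq tensor_contract_scalar)

lemma ext_contract_one [simp]: "ext_contract v 1 = 0"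
  by (simp add: one_exterior.abs_eq ext_contract.abs_eq tensor_contract_single zero_exterior.abs_eq
      zero_free_monoid_def flip: single_one)

lemma ext_contract_gen:
  "ext_contract v (ext_gen u * a) = (if u = v then a else 0) - ext_gen u * ext_contract v a"
  by (cases a rule: exterior_cases)
    (simp add: ext_gen_def times_exterior.abs_eq ext_contract.abs_eq tensor_contract_letter
      minus_exterior.abs_eq zero_exterior.abs_eq)

lemma ext_const_add: "ext_const (a + b) = ext_const a + ext_const b"
  by (cases a rule: exterior_cases; cases b rule: exterior_cases)
    (simp add: plus_exterior.abs_eq ext_const.abs_eq lookup_add)

lemma ext_const_mult: "ext_const (a * b) = ext_const a * ext_const b"
  by (cases a rule: exterior_cases; cases b rule: exterior_cases)
    (simp add: times_exterior.abs_eq ext_const.abs_eq lookup_zero_mult)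

lemma ext_const_zero [simp]: "ext_const 0 = 0"
  by (simp add: zero_exterior.abs_eq ext_const.abs_eq)

lemma ext_const_scalar [simp]: "ext_const (ext_scalar c) = c"
  by (simp add: ext_scalar_def ext_const.abs_eq)

lemma ext_const_gen [simp]: "ext_const (ext_gen v) = 0"
  by (simp add: ext_gen_def ext_const.abs_eq lookup_single zero_free_monoid_def)

section \<open>Derivatives and constant terms of forms\<close>

definition form_contract :: "'n \<times> 'n \<Rightarrow> ('n, 'k::comm_ring_1) mat_form \<Rightarrow> ('n, 'k) mat_form" where
  "form_contract v = pm_eval (\<lambda>a. Poly_Mapping.single 0 (ext_contract v a)) (\<lambda>k. Poly_Mapping.single k 1)"

text \<open>The formal partial derivative in the variable \<open>v\<close>. The truncated
  subtraction of exponents is harmless: if the exponent of \<open>v\<close> is 0, the coefficient is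
  0 as well.\<close>

definition form_deriv :: "'n \<times> 'n \<Rightarrow> ('n, 'k::comm_ring_1) mat_form \<Rightarrow> ('n, 'k) mat_form" where
  "form_deriv v = pm_eval (Poly_Mapping.single 0)
    (\<lambda>k. Poly_Mapping.single (k - Poly_Mapping.single v 1) (of_nat (Poly_Mapping.lookup k v)))"

definition form_const :: "('n, 'k::comm_ring_1) mat_form \<Rightarrow> 'k" where
  "form_const a = ext_const (Poly_Mapping.lookup a 0)"

text \<open>The letter \<open>(b, i, j)\<close> stands for \<open>dx\<^sub>i\<^sub>j\<close> if \<open>b\<close> holds and for \<open>x\<^sub>i\<^sub>j\<close> otherwise.\<close>

type_synonym 'n letter = "bool \<times> 'n \<times> 'n"

definition letter_mat :: "bool \<Rightarrow> ('n::finite, 'k::comm_ring_1) mat_form ^'n ^'n" where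
  "letter_mat b = (if b then dX_mat else X_mat)"

definition letter :: "'n letter \<Rightarrow> ('n::finite, 'k::comm_ring_1) mat_form" where
  "letter a = letter_mat (fst a) $ fst (snd a) $ snd (snd a)"

definition letter_deriv :: "'n letter \<Rightarrow> ('n, 'k::comm_ring_1) mat_form \<Rightarrow> ('n, 'k) mat_form" where
  "letter_deriv a = (if fst a then form_contract (snd a) else form_deriv (snd a))"

text \<open>The Koszul sign, with coordinates even and differentials odd. It is a form so that it
  can multiply forms directly.\<close>

definition letter_sign :: "'n letter \<Rightarrow> 'n letter \<Rightarrow> ('n, 'k::comm_ring_1) mat_form" where
  "letter_sign a b = (if fst a \<and> fst b then - 1 else 1)"

lemma form_contract_single:
  "form_contract v (Poly_Mapping.single k a) = Poly_Mapping.single k (ext_contract v a)"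
  by (simp add: form_contract_def pm_eval_single mult_single)

lemma form_deriv_single:
  "form_deriv v (Poly_Mapping.single k a) =
    Poly_Mapping.single (k - Poly_Mapping.single v 1) (a * of_nat (Poly_Mapping.lookup k v))"
  by (simp add: form_deriv_def pm_eval_single mult_single)

lemma letter_deriv_add: "letter_deriv a (x + y) = letter_deriv a x + letter_deriv a y"
  by (simp add: letter_deriv_def form_contract_def form_deriv_def pm_eval_add ext_contract_add single_add)

lemma letter_deriv_zero [simp]: "letter_deriv a 0 = 0"
  by (simp add: letter_deriv_def form_contract_def form_deriv_def pm_eval_zero)

lemma letter_deriv_scalar: "letter_deriv a (form_scalar c * x) = form_scalar c * letter_deriv a x"
  by (induction x rule: poly_mapping_monomial_induct)
    (simp_all add: letter_deriv_add distrib_left, simp add: letter_deriv_def form_scalar_def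
      mult_single form_contract_single form_deriv_single ext_contract_scalar mult.assoc)

lemma letter_deriv_one [simp]: "letter_deriv a 1 = 0"
  by (simp add: letter_deriv_def form_contract_single form_deriv_single flip: single_one)

text \<open>Partial derivatives and contractions obey one common signed Leibniz rule. Additivity
  reduces it to a single monomial with an exterior coefficient, where the kinds of the two letters
  are distinguished.\<close>

lemma letter_deriv_letter:
  "letter_deriv a (letter b * x) = (if a = b then x else 0) + letter_sign a b * (letter b * letter_deriv a x)"
proof (induction x rule: poly_mapping_monomial_induct)
  case (monomial k e)
  obtain p v q w where ab: "a = (p, v)" "b = (q, w)" by (cases a; cases b)
  let ?s = "\<lambda>v. Poly_Mapping.single v (1::nat)"
  \<comment> \<open>Exponents are subtracted with truncation: subtraction commutes with adding a
    different variable, but is undone by adding the same variable only if the exponent was positive.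
    Exponent 0 is a separate case below.\<close>
  have dec: "?s w + k - ?s v = ?s w + (k - ?s v)" if "v \<noteq> w"
    using that by (intro poly_mapping_eqI) (auto simp: lookup_add lookup_minus lookup_single when_def)
  have inc: "?s v + (k - ?s v) = k" if "Poly_Mapping.lookup k v \<noteq> 0"
    using that by (intro poly_mapping_eqI) (auto simp: lookup_add lookup_minus lookup_single when_def)
  show ?case
  proof (cases q)
    case True
    then have "letter b * Poly_Mapping.single k e = Poly_Mapping.single k (ext_gen w * e)" for k and e :: "('a \<times> 'a, 'b) exterior"
      by (simp add: ab letter_def letter_mat_def dX_mat_def mult_single)
    then show ?thesis
      using True by (cases p) (simp_all add: ab letter_deriv_def letter_sign_def form_contract_single
        form_deriv_single ext_contract_gen single_diff mult.assoc)
  next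
    case False
    have X: "letter (False, w) * Poly_Mapping.single k e = Poly_Mapping.single (?s w + k) e" for k and e :: "('a \<times> 'a, 'b) exterior"
      by (simp add: ab letter_def letter_mat_def X_mat_def mult_single)
    show ?thesis
    proof (cases p)
      case True
      then show ?thesis using False X by (simp add: ab letter_deriv_def letter_sign_def form_contract_single)
    next
      case p: False
      show ?thesis
      proof (cases "v = w")
        case True
        then show ?thesis
          using False p inc
          by (cases "Poly_Mapping.lookup k v = 0")
            (simp_all add: ab X letter_deriv_def letter_sign_def form_deriv_single lookup_add lookup_single
              distrib_left single_add)
      next
        case ne: False
        then show ?thesis
          using False p dec
          by (simp add: ab X letter_deriv_def letter_sign_def form_deriv_single lookup_add lookup_single when_def)
      qed
    qed
  qed
qed (simp_all add: letter_deriv_add distrib_left)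

lemma form_scalar_left_commute: "a * (form_scalar c * b) = form_scalar c * (a * b)"
proof -
  have "a * (form_scalar c * b) = form_scalar c * a * b"
    by (simp only: form_scalar_commute[of c a] mult.assoc)
  then show ?thesis by (simp only: mult.assoc)
qed

lemma form_scalar_of_nat: "form_scalar (of_nat n) = of_nat n"
  by (induction n) (simp_all add: form_scalar_add)

lemma form_scalar_uminus: "form_scalar (- c) = - form_scalar c"
  using form_scalar_add[of c "- c"] by (simp add: eq_neg_iff_add_eq_0 add.commute)

lemma dX_mat_linear: "dX_mat $ i $ j \<in> linear_forms"
  by (auto simp: dX_mat_def linear_forms_def ext_gen_def tensor_degree_one_def
      intro!: exI[of _ "Poly_Mapping.single (Free [(i, j)]) 1"])

lemma dX_mat_anticommute: "dX_mat $ i $ j * dX_mat $ k $ l = - (dX_mat $ k $ l * dX_mat $ i $ j)"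
proof -
  have "(dX_mat $ i $ j + dX_mat $ k $ l) * (dX_mat $ i $ j + dX_mat $ k $ l) = 0"
    by (intro linear_forms_square linear_forms_add dX_mat_linear)
  then show ?thesis
    by (simp add: distrib_left distrib_right linear_forms_square dX_mat_linear eq_neg_iff_add_eq_0 add.commute)
qed

lemma letter_deriv_form_scalar [simp]: "letter_deriv a (form_scalar c) = 0"
  using letter_deriv_scalar[of a c 1] by simp

text \<open>Coordinates are central and differentials anticommute. In Euler's identity this absorbs
  the sign of the Leibniz rule.\<close>

lemma letter_swap: "letter a * (letter_sign a b * letter b) = letter b * letter a"
proof (cases "fst a \<and> fst b")
  case True
  then show ?thesis
    by (simp add: letter_def letter_mat_def letter_sign_def) (subst dX_mat_anticommute, simp)
next
  case False
  then show ?thesis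
  proof (cases "fst a")
    case True
    then show ?thesis using False by (simp add: letter_def letter_mat_def letter_sign_def X_mat_commute)
  next
    case False
    then show ?thesis by (simp add: letter_def letter_mat_def[of False] letter_sign_def) (rule X_mat_commute)
  qed
qed

lemma form_const_add: "form_const (a + b) = form_const a + form_const b"
  by (simp add: form_const_def lookup_add ext_const_add)

lemma form_const_zero [simp]: "form_const 0 = 0"
  by (simp add: form_const_def)

lemma form_const_one [simp]: "form_const 1 = 1"
  using ext_const_scalar[of 1] by (simp add: form_const_def lookup_single flip: single_one)

lemma form_const_scalar: "form_const (form_scalar c * a) = c * form_const a"
  by (induction a rule: poly_mapping_monomial_induct)
    (auto simp: form_const_add distrib_left, auto simp: form_const_def form_scalar_def mult_single
      lookup_single when_def ext_const_mult)

lemma form_const_form_scalar [simp]: "form_const (form_scalar c) = c"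
  using form_const_scalar[of c 1] by simp

lemma form_const_sum: "form_const (\<Sum>x\<in>A. f x) = (\<Sum>x\<in>A. form_const (f x))"
  by (induction A rule: infinite_finite_induct) (simp_all add: form_const_add)

lemma form_const_letter: "form_const (letter a * x) = 0"
proof (induction x rule: poly_mapping_monomial_induct)
  case (monomial k e)
  have "Poly_Mapping.single v (1::nat) + k \<noteq> 0" for v
  proof
    assume "Poly_Mapping.single v (1::nat) + k = 0"
    then have "Poly_Mapping.lookup (Poly_Mapping.single v (1::nat) + k) v = 0" by simp
    then show False by (simp add: lookup_add)
  qed
  then show ?case
    by (auto simp: letter_def letter_mat_def X_mat_def dX_mat_def form_const_def mult_single
        lookup_single when_def ext_const_mult)
qed (simp_all add: form_const_add distrib_left)

section \<open>Words in the generators and their coefficients\<close>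

definition letter_word :: "'n letter list \<Rightarrow> ('n::finite, 'k::comm_ring_1) mat_form" where
  "letter_word as = prod_list (map letter as)"

text \<open>An iterated partial derivative at the origin, with contractions in place of derivatives
  for the differentials; the first letter of the word acts first.\<close>

primrec form_coeff :: "'n letter list \<Rightarrow> ('n, 'k::comm_ring_1) mat_form \<Rightarrow> 'k" where
  "form_coeff [] x = form_const x"
| "form_coeff (a # as) x = form_coeff as (letter_deriv a x)"

lemma form_coeff_add: "form_coeff as (x + y) = form_coeff as x + form_coeff as y"
  by (induction as arbitrary: x y) (simp_all add: form_const_add letter_deriv_add)

lemma form_coeff_zero [simp]: "form_coeff as 0 = 0"
  by (induction as) simp_all

lemma form_coeff_scalar: "form_coeff as (form_scalar c * x) = c * form_coeff as x"
  by (induction as arbitrary: x) (simp_all add: form_const_scalar letter_deriv_scalar)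

lemma form_coeff_sum: "form_coeff as (\<Sum>x\<in>A. f x) = (\<Sum>x\<in>A. form_coeff as (f x))"
  by (induction A rule: infinite_finite_induct) (simp_all add: form_coeff_add)

lemma letter_deriv_sum: "letter_deriv a (\<Sum>x\<in>A. f x) = (\<Sum>x\<in>A. letter_deriv a (f x))"
  by (induction A rule: infinite_finite_induct) (simp_all add: letter_deriv_add)

text \<open>Linear combinations of words form a subalgebra that contains the generators, so they
  exhaust all forms.\<close>

lemma form_word_induct [case_names word add]:
  fixes P :: "('n::finite, 'k::comm_ring_1) mat_form \<Rightarrow> bool"
  assumes word: "\<And>c as. P (form_scalar c * letter_word as)"
    and add: "\<And>x y. P x \<Longrightarrow> P y \<Longrightarrow> P (x + y)"
  shows "P x"
proof -
  define S :: "('n, 'k) mat_form set" where "S = {x. \<exists>xs. x = (\<Sum>(c, as)\<leftarrow>xs. form_scalar c * letter_word as)}"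
  have "form_subalgebra S"
    unfolding form_subalgebra_def
  proof (intro conjI ballI allI)
    fix c
    show "form_scalar c \<in> S" by (auto simp: S_def letter_word_def intro!: exI[of _ "[(c, [])]"])
  next
    fix x y assume "x \<in> S" "y \<in> S"
    then obtain xs ys where "x = (\<Sum>(c, as)\<leftarrow>xs. form_scalar c * letter_word as)"
      "y = (\<Sum>(c, as)\<leftarrow>ys. form_scalar c * letter_word as)" by (auto simp: S_def)
    then show "x + y \<in> S" by (auto simp: S_def intro!: exI[of _ "xs @ ys"])
  next
    fix x y assume "x \<in> S" "y \<in> S"
    then obtain xs ys where x: "x = (\<Sum>(c, as)\<leftarrow>xs. form_scalar c * letter_word as)"
      and y: "y = (\<Sum>(c, as)\<leftarrow>ys. form_scalar c * letter_word as)" by (auto simp: S_def)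
    have "x * y = (\<Sum>(c, as)\<leftarrow>[(c * d, as @ bs). (c, as) \<leftarrow> xs, (d, bs) \<leftarrow> ys]. form_scalar c * letter_word as)"
      unfolding x
    proof (induction xs)
      case (Cons p xs)
      obtain c as where p: "p = (c, as)" by (cases p)
      have "form_scalar c * letter_word as * y =
        (\<Sum>(c, as)\<leftarrow>map (\<lambda>(d, bs). (c * d, as @ bs)) ys. form_scalar c * letter_word as)"
        unfolding y
        by (induction ys) (auto simp: distrib_left letter_word_def form_scalar_mult mult.assoc
            form_scalar_left_commute[of "prod_list _"])
      then show ?case using Cons by (simp add: p distrib_right)
    qed simp
    then show "x * y \<in> S" unfolding S_def by blast
  qed
  moreover have letter: "letter a \<in> S" for a
    by (auto simp: S_def letter_word_def intro!: exI[of _ "[(1, [a])]"])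
  have "X_mat $ i $ j \<in> S" "dX_mat $ i $ j \<in> S" for i j
    using letter[of "(False, i, j)"] letter[of "(True, i, j)"] by (simp_all add: letter_def letter_mat_def)
  ultimately have "x \<in> S" by (rule form_subalgebra_generators)
  then obtain xs where "x = (\<Sum>(c, as)\<leftarrow>xs. form_scalar c * letter_word as)" by (auto simp: S_def)
  moreover have "P (\<Sum>(c, as)\<leftarrow>xs. form_scalar c * letter_word as)"
  proof (induction xs)
    case Nil
    show ?case using word[of 0 "[]"] by simp
  qed (auto intro: word add)
  ultimately show ?thesis by simp
qed

section \<open>Homogeneous forms and Euler's identity\<close>

text \<open>The degree is the total one: coordinates and differentials both count 1. The zero form
  lies in every degree.\<close>

inductive_set homogeneous_forms :: "nat \<Rightarrow> ('n::finite, 'k::comm_ring_1) mat_form set" for m where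
  word: "length as = m \<Longrightarrow> form_scalar c * letter_word as \<in> homogeneous_forms m"
| add: "x \<in> homogeneous_forms m \<Longrightarrow> y \<in> homogeneous_forms m \<Longrightarrow> x + y \<in> homogeneous_forms m"

lemma homogeneous_forms_scalar:
  "x \<in> homogeneous_forms m \<Longrightarrow> form_scalar c * x \<in> homogeneous_forms m"
proof (induction rule: homogeneous_forms.induct)
  case (word as d)
  then show ?case using homogeneous_forms.word[of as m "c * d"] by (simp add: form_scalar_mult mult.assoc)
qed (simp add: distrib_left homogeneous_forms.add)

lemma homogeneous_forms_letter:
  "x \<in> homogeneous_forms m \<Longrightarrow> letter a * x \<in> homogeneous_forms (Suc m)"
proof (induction rule: homogeneous_forms.induct)
  case (word as d)
  then show ?case using homogeneous_forms.word[of "a # as" "Suc m" d]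
    by (simp add: letter_word_def form_scalar_left_commute)
qed (simp add: distrib_left homogeneous_forms.add)

lemma homogeneous_forms_zero: "0 \<in> homogeneous_forms m"
  using homogeneous_forms.word[of "replicate m undefined" m 0] by simp

lemma homogeneous_forms_sign: "x \<in> homogeneous_forms m \<Longrightarrow> letter_sign a b * x \<in> homogeneous_forms m"
proof -
  assume "x \<in> homogeneous_forms m"
  then show ?thesis
    using homogeneous_forms_scalar[of x m "- 1"] by (simp add: letter_sign_def form_scalar_uminus)
qed

lemma letter_deriv_word:
  "letter_deriv a (letter_word (b # bs)) =
    (if a = b then letter_word bs else 0) + letter_sign a b * (letter b * letter_deriv a (letter_word bs))"
  by (simp add: letter_word_def letter_deriv_letter)

text \<open>The Leibniz rule removes one letter from a word. Degree 0 is singled out because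
  \<open>m - 1\<close> is then again 0, while the operators kill constants.\<close>

lemma homogeneous_forms_deriv:
  fixes x :: "('n::finite, 'k::comm_ring_1) mat_form"
  assumes "x \<in> homogeneous_forms m"
  shows "letter_deriv a x \<in> homogeneous_forms (m - 1)" "m = 0 \<Longrightarrow> letter_deriv a x = 0"
proof -
  have word: "letter_deriv a (letter_word as :: ('n, 'k) mat_form) \<in> homogeneous_forms (length as - 1)" for as
  proof (induction as)
    case (Cons b bs)
    have "(letter_word bs :: ('n, 'k) mat_form) \<in> homogeneous_forms (length bs)"
      using homogeneous_forms.word[of bs "length bs" 1] by simp
    moreover have "letter b * letter_deriv a (letter_word bs :: ('n, 'k) mat_form) \<in> homogeneous_forms (length bs)"
    proof (cases bs)
      case Nil
      then show ?thesis by (simp add: letter_word_def homogeneous_forms_zero)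
    next
      case (Cons b' bs')
      then show ?thesis using homogeneous_forms_letter[OF Cons.IH, of b] by simp
    qed
    ultimately show ?case
      unfolding letter_deriv_word
      by (auto intro!: homogeneous_forms.add homogeneous_forms_zero homogeneous_forms_sign)
  qed (simp add: letter_word_def homogeneous_forms_zero)
  show "letter_deriv a x \<in> homogeneous_forms (m - 1)"
    using assms by induction
      (use word in \<open>auto simp: letter_deriv_scalar letter_deriv_add intro: homogeneous_forms_scalar homogeneous_forms.add\<close>)
  show "letter_deriv a x = 0" if "m = 0"
    using assms by induction (use that in \<open>auto simp: letter_deriv_scalar letter_deriv_add letter_word_def\<close>)
qed

text \<open>Induction on a word: the Leibniz rule splits off the first letter, and moving
  \<open>letter a\<close> past it cancels the sign. Each letter of the word thus contributes the
  word once.\<close>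

lemma euler_identity:
  fixes x :: "('n::finite, 'k::comm_ring_1) mat_form"
  assumes "x \<in> homogeneous_forms m"
  shows "(\<Sum>a\<in>UNIV. letter a * letter_deriv a x) = of_nat m * x"
proof -
  have word: "(\<Sum>a\<in>UNIV. letter a * letter_deriv a (letter_word as)) =
      of_nat (length as) * (letter_word as :: ('n, 'k) mat_form)" for as
  proof (induction as)
    case (Cons b bs)
    let ?D = "\<lambda>a. letter_deriv a (letter_word bs :: ('n, 'k) mat_form)"
    have "letter a * letter_deriv a (letter_word (b # bs) :: ('n, 'k) mat_form) =
      (if a = b then letter b * letter_word bs else 0) + letter b * (letter a * ?D a)" for a
    proof -
      have "letter a * (letter_sign a b * (letter b * ?D a)) = letter a * (letter_sign a b * letter b) * ?D a"
        by (simp add: mult.assoc)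
      then show ?thesis
        unfolding letter_deriv_word by (simp add: letter_swap distrib_left mult.assoc)
    qed
    then have "(\<Sum>a\<in>UNIV. letter a * letter_deriv a (letter_word (b # bs))) =
      letter b * letter_word bs + letter b * (\<Sum>a\<in>UNIV. letter a * ?D a)"
      by (simp add: sum.distrib sum_distrib_left)
    also have "\<dots> = of_nat (length (b # bs)) * letter_word (b # bs)"
      using Cons by (simp add: letter_word_def distrib_right mult_of_nat_commute mult.assoc)
    finally show ?case .
  qed (simp add: letter_word_def)
  note letter_sum = word
  show ?thesis
    using assms
  proof induction
    case (word as c)
    then show ?case
      using letter_sum[of as]
      by (simp add: letter_deriv_scalar form_scalar_left_commute flip: sum_distrib_left)
  qed (simp add: letter_deriv_add distrib_left sum.distrib)
qed

lemma sum_lists_Suc: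
  fixes f :: "'a::finite list \<Rightarrow> 'b::comm_monoid_add"
  shows "(\<Sum>as | length as = Suc m. f as) = (\<Sum>a\<in>UNIV. \<Sum>as | length as = m. f (a # as))"
  unfolding sum.cartesian_product
  by (rule sum.reindex_bij_witness[of _ "\<lambda>(a, as). a # as" "\<lambda>as. (hd as, tl as)"])
    (auto simp: length_Suc_conv)

section \<open>Recovering a form from its coefficients\<close>

definition form_component :: "nat \<Rightarrow> ('n::finite, 'k::comm_ring_1) mat_form \<Rightarrow> ('n, 'k) mat_form" where
  "form_component m x = (\<Sum>as | length as = m. form_scalar (form_coeff as x) * letter_word as)"

lemma form_component_Suc:
  "form_component (Suc m) x = (\<Sum>a\<in>UNIV. letter a * form_component m (letter_deriv a x))"
  unfolding form_component_def sum_lists_Suc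
  by (simp add: letter_word_def sum_distrib_left form_scalar_left_commute)

lemma form_component_zero [simp]: "form_component m 0 = 0"
  by (simp add: form_component_def)

lemma form_component_add: "form_component m (x + y) = form_component m x + form_component m y"
  by (simp add: form_component_def form_coeff_add form_scalar_add distrib_right sum.distrib)

text \<open>For \<open>m = r\<close>, iterating Euler's identity produces the factors of the
  factorial. For \<open>m > r\<close> the iterated derivatives vanish; for \<open>m < r\<close> they
  have positive degree and hence constant term 0.\<close>

lemma form_component_homogeneous:
  fixes x :: "('n::finite, 'k::comm_ring_1) mat_form"
  assumes "x \<in> homogeneous_forms r"
  shows "form_component m x = (if m = r then of_nat (fact m) * x else 0)"
  using assms
proof (induction m arbitrary: r x)
  case 0
  show ?case
    using 0
  proof induction
    case (word as c)
    then show ?case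
      by (cases as) (auto simp: form_component_def letter_word_def form_const_scalar form_const_letter)
  qed (auto simp: form_component_add)
next
  case (Suc m)
  show ?case
  proof (cases r)
    case 0
    then show ?thesis using homogeneous_forms_deriv(2)[OF Suc.prems] by (simp add: form_component_Suc)
  next
    case (Suc r')
    have comm: "letter a * (of_nat (fact m) * y) = of_nat (fact m) * (letter a * y)" for a and y :: "('n, 'k) mat_form"
      using form_scalar_left_commute[of "letter a" "of_nat (fact m)" y] by (simp add: form_scalar_of_nat)
    have "form_component m (letter_deriv a x) = (if m = r' then of_nat (fact m) * letter_deriv a x else 0)" for a
      by (rule Suc.IH) (use homogeneous_forms_deriv(1)[OF Suc.prems] Suc in simp)
    then have "form_component (Suc m) x =
      (if m = r' then of_nat (fact m) * (\<Sum>a\<in>UNIV. letter a * letter_deriv a x) else 0)"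
      using comm by (cases "m = r'") (simp_all add: form_component_Suc sum_distrib_left)
    moreover have "of_nat (fact (Suc m)) = (of_nat (fact m) * of_nat (Suc m) :: ('n, 'k) mat_form)"
      by (simp only: fact_Suc of_nat_mult[symmetric] of_nat_id mult.commute)
    ultimately show ?thesis
      using Suc euler_identity[OF Suc.prems]
      by (cases "m = r'") (simp_all add: mult.assoc del: of_nat_Suc fact_Suc of_nat_mult)
  qed
qed

text \<open>A form has components in finitely many degrees only, and in characteristic zero the
  factor \<open>fact m\<close> on each of them can be divided out.\<close>

lemma form_expansion:
  fixes x :: "('n::finite, 'k::field_char_0) mat_form"
  shows "\<exists>N. x = (\<Sum>m<N. form_scalar (1 / fact m) * form_component m x)"
proof -
  \<comment> \<open>Allowing all larger bounds lets two summands share one.\<close>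
  have "\<exists>N. \<forall>M\<ge>N. x = (\<Sum>m<M. form_scalar (1 / fact m) * form_component m x)"
  proof (induction x rule: form_word_induct)
    case (word c as)
    let ?x = "form_scalar c * letter_word as :: ('n, 'k) mat_form"
    show ?case
    proof (intro exI allI impI)
      fix M assume M: "M \<ge> Suc (length as)"
      have "?x \<in> homogeneous_forms (length as)" by (rule homogeneous_forms.word) simp
      then have "(\<Sum>m<M. form_scalar (1 / fact m) * form_component m ?x) =
        (\<Sum>m<M. if m = length as then form_scalar (1 / fact m) * (of_nat (fact m) * ?x) else 0)"
        by (intro sum.cong refl) (auto simp: form_component_homogeneous)
      also have "\<dots> = form_scalar (1 / fact (length as)) * (of_nat (fact (length as)) * ?x)"
        using M by simp
      also have "of_nat (fact (length as)) = form_scalar (of_nat (fact (length as)))"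
        by (rule form_scalar_of_nat[symmetric])
      finally show "?x = (\<Sum>m<M. form_scalar (1 / fact m) * form_component m ?x)"
        by (simp flip: mult.assoc form_scalar_mult)
    qed
  next
    case (add x y)
    then obtain N N' where "\<forall>M\<ge>N. x = (\<Sum>m<M. form_scalar (1 / fact m) * form_component m x)"
      "\<forall>M\<ge>N'. y = (\<Sum>m<M. form_scalar (1 / fact m) * form_component m y)" by blast
    then have "\<forall>M\<ge>max N N'. x + y = (\<Sum>m<M. form_scalar (1 / fact m) * form_component m (x + y))"
      by (simp add: form_component_add distrib_left sum.distrib)
    then show ?case by blast
  qed
  then show ?thesis by blast
qed

section \<open>Equivariance of the coefficients\<close>

text \<open>The matrix of conjugation on the generators: coordinates and differentials transform by
  the same coefficients and do not mix.\<close>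

definition conj_coeff :: "'k::field ^'n ^'n \<Rightarrow> 'n::finite letter \<Rightarrow> 'n letter \<Rightarrow> 'k" where
  "conj_coeff g = (\<lambda>(b, i, j) (b', k, l). if b = b' then g $ i $ k * matrix_inv g $ l $ j else 0)"

lemma sum_letters: "(\<Sum>a\<in>UNIV. f a) = (\<Sum>b\<in>UNIV. \<Sum>i\<in>UNIV. \<Sum>j\<in>UNIV. f (b, i, j))"
  by (simp only: sum.cartesian_product UNIV_Times_UNIV case_prod_unfold prod.collapse)

lemma pullback_letter:
  assumes "is_pullback g F"
  shows "F (letter a) = (\<Sum>c\<in>UNIV. form_scalar (conj_coeff g a c) * letter c)"
proof -
  obtain b i j where a: "a = (b, i, j)" by (cases a)
  have "F (letter a) = conj_mat g (letter_mat b) $ i $ j"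
    using assms by (simp add: a letter_def letter_mat_def is_pullback_def)
  also have "\<dots> = (\<Sum>k\<in>UNIV. \<Sum>l\<in>UNIV. form_scalar (g $ i $ k * matrix_inv g $ l $ j) * letter (b, k, l))"
    unfolding conj_mat_nth
    by (subst sum.swap)
      (simp add: sum_distrib_right letter_def form_scalar_mult mult.assoc
        form_scalar_commute[of _ "letter_mat b $ _ $ _", symmetric])
  also have "\<dots> = (\<Sum>c\<in>UNIV. form_scalar (conj_coeff g a c) * letter c)"
    by (cases b) (simp_all add: sum_letters a conj_coeff_def UNIV_bool)
  finally show ?thesis .
qed

text \<open>The chain rule for a linear substitution. The coefficients occur transposed because the
  operators are dual to the generators.\<close>

lemma letter_deriv_pullback:
  assumes F: "is_pullback g F"
  shows "letter_deriv v (F x) = (\<Sum>w\<in>UNIV. form_scalar (conj_coeff g w v) * F (letter_deriv w x))"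
proof (induction x rule: form_word_induct)
  have hom: "form_alg_hom F" using F by (simp add: is_pullback_def)
  note F_simps = form_alg_homD[OF hom]
  have F0: "F 0 = 0" using F_simps(3)[of 0] by simp
  have F1: "F 1 = 1" using F_simps(3)[of 1] by simp
  \<comment> \<open>Nonzero coefficients link only letters of the same kind, and signs depend on
    kinds alone, so the sign may be taken with respect to either letter.\<close>
  have swap1: "form_scalar (conj_coeff g b c) * (letter_sign v c * y) =
      letter_sign v b * (form_scalar (conj_coeff g b c) * y)" for b c y
    by (cases b; cases c; cases v) (simp add: conj_coeff_def letter_sign_def)
  have swap2: "letter_sign v b * (z * (form_scalar (conj_coeff g w v) * y)) =
      form_scalar (conj_coeff g w v) * (letter_sign w b * (z * y))" for b w y z
    by (cases b; cases w; cases v) (simp add: conj_coeff_def letter_sign_def form_scalar_left_commute[of z])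
  have F_minus: "F (- x) = - F x" for x
    using F_simps(1)[of "- x" x] by (simp add: F0 eq_neg_iff_add_eq_0)
  have F_sign: "F (letter_sign a b * (y * x)) = letter_sign a b * (F y * F x)" for a b y x
    by (simp add: F_minus F1 letter_sign_def F_simps(2))
  case (word c as)
  have "letter_deriv v (F (letter_word as)) =
    (\<Sum>w\<in>UNIV. form_scalar (conj_coeff g w v) * F (letter_deriv w (letter_word as)))"
  proof (induction as)
    case (Cons b bs)
    let ?y = "letter_word bs" and ?G = "\<lambda>b c. form_scalar (conj_coeff g b c)"
    have "letter_deriv v (F (letter_word (b # bs))) = letter_deriv v (\<Sum>c\<in>UNIV. ?G b c * (letter c * F ?y))"
      by (simp add: letter_word_def F_simps pullback_letter[OF F] sum_distrib_right mult.assoc)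
    also have "\<dots> = (\<Sum>c\<in>UNIV. ?G b c * ((if v = c then F ?y else 0) + letter_sign v c * (letter c * letter_deriv v (F ?y))))"
      by (simp add: letter_deriv_sum letter_deriv_scalar letter_deriv_letter)
    also have "\<dots> = (\<Sum>c\<in>UNIV. (if v = c then ?G b c * F ?y else 0) +
        letter_sign v b * (?G b c * letter c * letter_deriv v (F ?y)))"
    proof (intro sum.cong refl)
      fix c
      show "?G b c * ((if v = c then F ?y else 0) + letter_sign v c * (letter c * letter_deriv v (F ?y))) =
        (if v = c then ?G b c * F ?y else 0) + letter_sign v b * (?G b c * letter c * letter_deriv v (F ?y))"
        by (simp add: distrib_left swap1 mult.assoc)
    qed
    also have "\<dots> = ?G b v * F ?y + letter_sign v b * (F (letter b) * letter_deriv v (F ?y))"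
      by (simp add: sum.distrib pullback_letter[OF F] sum_distrib_left sum_distrib_right)
    also have "\<dots> = ?G b v * F ?y + (\<Sum>w\<in>UNIV. ?G w v * (letter_sign w b * (F (letter b) * F (letter_deriv w ?y))))"
      by (simp add: Cons sum_distrib_left swap2)
    also have "\<dots> = (\<Sum>w\<in>UNIV. ?G w v * F ((if w = b then ?y else 0) + letter_sign w b * (letter b * letter_deriv w ?y)))"
      by (simp add: F_simps(1) F_sign distrib_left sum.distrib if_distrib[of F] if_distrib[of "(*) _"] F0 cong: if_cong)
    also have "\<dots> = (\<Sum>w\<in>UNIV. ?G w v * F (letter_deriv w (letter_word (b # bs))))"
      by (simp only: letter_deriv_word)
    finally show ?case .
  qed (simp add: letter_word_def F0 F1)
  then show ?case
    by (simp add: F_simps letter_deriv_scalar sum_distrib_left mult.commute[of c]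
        flip: mult.assoc form_scalar_mult)
next
  case (add x y)
  moreover have "form_alg_hom F" using F by (simp add: is_pullback_def)
  ultimately show ?case
    by (simp add: form_alg_homD letter_deriv_add distrib_left sum.distrib)
qed

text \<open>Each letter pulls back to a combination of letters, so words of positive length keep
  constant term 0.\<close>

lemma form_const_pullback:
  assumes F: "is_pullback g F"
  shows "form_const (F x) = form_const x"
proof (induction x rule: form_word_induct)
  have hom: "form_alg_hom F" using F by (simp add: is_pullback_def)
  note F_simps = form_alg_homD[OF hom]
  have F1: "F 1 = 1" using F_simps(3)[of 1] by simp
  case (word c as)
  show ?case
    by (cases as) (simp_all add: F_simps F1 form_const_scalar letter_word_def pullback_letter[OF F]
        sum_distrib_right form_const_sum mult.assoc form_const_letter)
next
  case (add x y)
  moreover have "form_alg_hom F" using F by (simp add: is_pullback_def)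
  ultimately show ?case by (simp add: form_alg_homD form_const_add)
qed

text \<open>Iterating the chain rule, one letter at a time, shows that the coefficients transform as
  the components of a tensor.\<close>

lemma form_coeff_pullback:
  assumes F: "is_pullback g F"
  shows "form_coeff as (F x) =
    (\<Sum>bs | length bs = length as. prod_list (map2 (conj_coeff g) bs as) * form_coeff bs x)"
proof (induction as arbitrary: x)
  case Nil
  show ?case using form_const_pullback[OF F] by simp
next
  case (Cons a as)
  show ?case
    by (simp add: letter_deriv_pullback[OF F] form_coeff_sum form_coeff_scalar Cons sum_lists_Suc
        sum_distrib_left mult.assoc)
qed

section \<open>Traces of words and contractions\<close>

text \<open>One sign serves all pairs of entries, so that it can be pulled out of the sums in matrix
  products and traces.\<close>

definition sign_commute :: "'a::ring_1 ^'n ^'n \<Rightarrow> 'a ^'n ^'n \<Rightarrow> bool" where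
  "sign_commute A B \<longleftrightarrow>
    (\<exists>s\<in>{1, - 1}. \<forall>i j k l. A $ i $ j * B $ k $ l = s * (B $ k $ l * A $ i $ j))"

lemma sign_commute_sym:
  assumes "sign_commute A B"
  shows "sign_commute B A"
proof -
  obtain s where s: "s \<in> {1, - 1}" "\<And>i j k l. A $ i $ j * B $ k $ l = s * (B $ k $ l * A $ i $ j)"
    using assms unfolding sign_commute_def by blast
  have "B $ i $ j * A $ k $ l = s * (A $ k $ l * B $ i $ j)" for i j k l
    using s(1) by (auto simp: s(2))
  then show ?thesis using s(1) unfolding sign_commute_def by blast
qed

lemma sign_commute_one: "sign_commute (mat 1) B"
  unfolding sign_commute_def by (intro bexI[of _ 1]) (auto simp: mat_def)

lemma sign_commute_mult:
  fixes A B C :: "'a::ring_1 ^'n::finite ^'n"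
  assumes "sign_commute A C" "sign_commute B C"
  shows "sign_commute (A ** B) C"
proof -
  obtain s t where s: "s \<in> {1, - 1}" "\<And>i j k l. A $ i $ j * C $ k $ l = s * (C $ k $ l * A $ i $ j)"
    and t: "t \<in> {1, - 1}" "\<And>i j k l. B $ i $ j * C $ k $ l = t * (C $ k $ l * B $ i $ j)"
    using assms unfolding sign_commute_def by blast
  have "A $ i $ m * B $ m $ j * C $ k $ l = s * t * (C $ k $ l * (A $ i $ m * B $ m $ j))" for i j k l m
  proof -
    have "A $ i $ m * B $ m $ j * C $ k $ l = t * (A $ i $ m * C $ k $ l * B $ m $ j)"
      using t(1) by (auto simp: t(2) mult.assoc)
    also have "\<dots> = s * t * (C $ k $ l * (A $ i $ m * B $ m $ j))"
      using s(1) t(1) by (auto simp: s(2) mult.assoc)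
    finally show ?thesis .
  qed
  then have "(A ** B) $ i $ j * C $ k $ l = s * t * (C $ k $ l * (A ** B) $ i $ j)" for i j k l
    by (simp add: matrix_matrix_mult_def sum_distrib_left sum_distrib_right)
  moreover have "s * t \<in> {1, - 1}" using s(1) t(1) by auto
  ultimately show ?thesis unfolding sign_commute_def by blast
qed

lemma trace_rotate:
  fixes A B :: "'a::ring_1 ^'n::finite ^'n"
  assumes "sign_commute A B"
  shows "\<exists>s\<in>{1, - 1}. trace (A ** B) = s * trace (B ** A)"
proof -
  obtain s where s: "s \<in> {1, - 1}" "\<And>i j k l. A $ i $ j * B $ k $ l = s * (B $ k $ l * A $ i $ j)"
    using assms unfolding sign_commute_def by blast
  have "trace (A ** B) = (\<Sum>i\<in>UNIV. \<Sum>k\<in>UNIV. s * (B $ k $ i * A $ i $ k))"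
    by (simp add: trace_def matrix_matrix_mult_def s(2))
  also have "\<dots> = s * trace (B ** A)"
    by (subst sum.swap) (simp add: trace_def matrix_matrix_mult_def sum_distrib_left)
  finally show ?thesis using s(1) by blast
qed

section \<open>Traces of words in the coordinate and differential matrices\<close>

primrec word_mat :: "bool list \<Rightarrow> ('n::finite, 'k::comm_ring_1) mat_form ^'n ^'n" where
  "word_mat [] = mat 1"
| "word_mat (b # bs) = letter_mat b ** word_mat bs"

lemma word_mat_append: "word_mat (bs @ cs) = word_mat bs ** word_mat cs"
  by (induction bs) (simp_all add: matrix_mul_assoc)

lemma sign_commute_X: "sign_commute X_mat A"
  unfolding sign_commute_def by (intro bexI[of _ 1]) (simp_all add: X_mat_commute)

lemma sign_commute_dX: "sign_commute dX_mat dX_mat"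
  unfolding sign_commute_def
proof (intro bexI[of _ "- 1"] allI)
  show "dX_mat $ i $ j * dX_mat $ k $ l = - 1 * (dX_mat $ k $ l * dX_mat $ i $ j)" for i j k l
    unfolding mult_minus1 by (rule dX_mat_anticommute)
qed simp

lemma sign_commute_word_mat: "sign_commute (word_mat bs) (word_mat cs)"
proof -
  have letter: "sign_commute (letter_mat b) (letter_mat c)" for b c
    by (cases b; cases c) (auto simp: letter_mat_def sign_commute_X sign_commute_dX intro: sign_commute_sym)
  have "sign_commute (word_mat bs) (letter_mat c)" for c
    by (induction bs) (auto intro: sign_commute_one sign_commute_mult letter)
  then show ?thesis
    by (induction cs) (auto intro: sign_commute_sym sign_commute_one sign_commute_mult)
qed

lemma word_mat_eq_power: "word_mat (replicate l False) = mat_power X_mat l"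
  by (induction l) (simp_all add: letter_mat_def)

text \<open>A word ending in dX splits into blocks of a power of X followed by dX. Prepending dX
  opens a block with exponent 0; prepending X raises the first exponent.\<close>

lemma word_mat_eq_omega:
  "\<exists>ls. ls \<noteq> [] \<and> (word_mat (bs @ [True]) :: ('n::finite, 'k::comm_ring_1) mat_form ^'n ^'n) =
    foldr (\<lambda>l M. mat_power X_mat l ** dX_mat ** M) ls (mat 1)"
proof (induction bs)
  case Nil
  show ?case by (intro exI[of _ "[0]"]) (simp add: letter_mat_def)
next
  case (Cons b bs)
  then obtain ls where ls: "ls \<noteq> []"
    "(word_mat (bs @ [True]) :: ('n, 'k) mat_form ^'n ^'n) =
      foldr (\<lambda>l M. mat_power X_mat l ** dX_mat ** M) ls (mat 1)" by blast
  show ?case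
  proof (cases b)
    case True
    then show ?thesis using ls by (intro exI[of _ "0 # ls"]) (simp add: letter_mat_def)
  next
    case False
    obtain l ls' where "ls = l # ls'" using ls(1) by (cases ls) auto
    then show ?thesis
      using False ls(2) by (intro exI[of _ "Suc l # ls'"]) (simp add: letter_mat_def matrix_mul_assoc)
  qed
qed

lemma form_subalgebraD:
  assumes "form_subalgebra S"
  shows "form_scalar c \<in> S" "0 \<in> S" "1 \<in> S" "- 1 \<in> S"
    "a \<in> S \<Longrightarrow> b \<in> S \<Longrightarrow> a + b \<in> S" "a \<in> S \<Longrightarrow> b \<in> S \<Longrightarrow> a * b \<in> S"
proof -
  show scalar: "form_scalar c \<in> S" for c using assms by (simp add: form_subalgebra_def)
  show "0 \<in> S" "1 \<in> S" "- 1 \<in> S"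
    using scalar[of 0] scalar[of 1] scalar[of "- 1"] by (simp_all add: form_scalar_uminus)
qed (use assms in \<open>simp_all add: form_subalgebra_def\<close>)

lemma form_subalgebra_sum:
  assumes "form_subalgebra S" "\<And>x. x \<in> A \<Longrightarrow> f x \<in> S"
  shows "sum f A \<in> S"
  using assms(2) by (induction A rule: infinite_finite_induct) (auto intro: form_subalgebraD[OF assms(1)])

lemma form_subalgebra_sign:
  assumes "form_subalgebra S" "s \<in> {1, - 1}" "a \<in> S"
  shows "s * a \<in> S"
  using assms form_subalgebraD(3,4,6)[OF assms(1)] by blast

text \<open>Rotation brings an occurrence of dX to the end at the cost of a sign, which yields some
  \<open>omega ls\<close>. A word without dX is a power of X.\<close>

lemma trace_word_mat_mem:
  fixes S :: "('n::finite, 'k::comm_ring_1) mat_form set"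
  assumes S: "form_subalgebra S"
    and power: "\<And>l. l \<ge> 1 \<Longrightarrow> trace (mat_power X_mat l) \<in> S"
    and omega: "\<And>ls. ls \<noteq> [] \<Longrightarrow> omega ls \<in> S"
  shows "trace (word_mat bs) \<in> S"
proof (cases "True \<in> set bs")
  case True
  then obtain cs ds where bs: "bs = (cs @ [True]) @ ds" by (auto dest: split_list)
  obtain s where s: "s \<in> {1, - 1}"
    "trace (word_mat bs :: ('n, 'k) mat_form ^'n ^'n) = s * trace (word_mat (ds @ cs @ [True]))"
    using trace_rotate[OF sign_commute_word_mat[of "cs @ [True]" ds]]
    by (auto simp only: bs word_mat_append)
  obtain ls where "ls \<noteq> []" "(word_mat ((ds @ cs) @ [True]) :: ('n, 'k) mat_form ^'n ^'n) =
    foldr (\<lambda>l M. mat_power X_mat l ** dX_mat ** M) ls (mat 1)"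
    using word_mat_eq_omega by blast
  then have "trace (word_mat (ds @ cs @ [True])) \<in> S" using omega[of ls] by (simp add: omega_def)
  then show ?thesis using form_subalgebra_sign[OF S s(1)] s(2) by simp
next
  case False
  define l where "l = length bs"
  have bs: "bs = replicate l False"
  proof (rule replicate_eqI)
    show "y = False" if "y \<in> set bs" for y using that False by (cases y) auto
  qed (simp add: l_def)
  show ?thesis
  proof (cases "l = 0")
    case True
    \<comment> \<open>The exponent 0 is not among the generators; the trace of the identity is a sum
      of ones and hence in \<open>S\<close>.\<close>
    have "trace (mat 1 :: ('n, 'k) mat_form ^'n ^'n) \<in> S"
      unfolding trace_def by (intro form_subalgebra_sum[OF S]) (simp add: mat_def form_subalgebraD(3)[OF S])
    then show ?thesis using True by (simp add: bs)
  next
    case False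
    then show ?thesis using power[of l] by (simp add: bs word_mat_eq_power)
  qed
qed

section \<open>Contraction of indices along the cycles of a permutation\<close>

lemma sum_PiE_insert:
  assumes "a \<notin> A"
  shows "(\<Sum>J\<in>insert a A \<rightarrow>\<^sub>E B. f J) = (\<Sum>J\<in>A \<rightarrow>\<^sub>E B. \<Sum>x\<in>B. f (J(a := x)))"
proof -
  have "(\<Sum>J\<in>insert a A \<rightarrow>\<^sub>E B. f J) = (\<Sum>(x, J)\<in>B \<times> (A \<rightarrow>\<^sub>E B). f (J(a := x)))"
    unfolding PiE_insert_eq
    by (subst sum.reindex[OF inj_combinator[OF assms]]) (simp add: case_prod_unfold)
  then show ?thesis by (subst sum.swap) (simp add: sum.cartesian_product)
qed

text \<open>The sign is determined by the words and not by the index values, so it can leave the sum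
  over \<open>J\<close>.\<close>

lemma prod_list_sign_commute:
  "\<exists>s\<in>{1, - 1 :: ('n::finite, 'k::comm_ring_1) mat_form}.
    \<forall>J. prod_list (map (\<lambda>i. word_mat (w i) $ J (\<sigma> i) $ J i) ps) * (word_mat bs $ J k $ J l) =
    s * ((word_mat bs $ J k $ J l) * prod_list (map (\<lambda>i. word_mat (w i) $ J (\<sigma> i) $ J i) ps))"
proof (induction ps)
  case Nil
  show ?case by (intro bexI[of _ 1]) simp_all
next
  case (Cons p ps)
  let ?P = "\<lambda>J. prod_list (map (\<lambda>i. word_mat (w i) $ J (\<sigma> i) $ J i) ps) :: ('n, 'k) mat_form"
  let ?b = "\<lambda>J. word_mat bs $ J k $ J l :: ('n, 'k) mat_form"
  let ?p = "\<lambda>J. word_mat (w p) $ J (\<sigma> p) $ J p :: ('n, 'k) mat_form"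
  obtain s where s: "s \<in> {1, - 1}" "\<And>J. ?P J * ?b J = s * (?b J * ?P J)" using Cons by blast
  obtain t where t: "t \<in> {1, - 1}" "\<And>J. ?p J * ?b J = t * (?b J * ?p J)"
    using sign_commute_word_mat[of "w p" bs] unfolding sign_commute_def by blast
  have "?p J * ?P J * ?b J = s * t * (?b J * (?p J * ?P J))" for J
  proof -
    have "?p J * ?P J * ?b J = s * (?p J * ?b J * ?P J)"
      using s(1) by (auto simp: s(2) mult.assoc)
    also have "\<dots> = s * t * (?b J * (?p J * ?P J))"
      using t(1) s(1) by (auto simp: t(2) mult.assoc)
    finally show ?thesis .
  qed
  then show ?case using s(1) t(1) by (intro bexI[of _ "s * t"]) auto
qed

text \<open>
  Contracting the letters along the cycles of \<open>\<sigma>\<close>: a fixed point splits off a trace, and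
  otherwise the factor of \<open>a\<close> is multiplied with the factor of \<open>\<sigma>\<inverse> a\<close>.
\<close>

lemma contraction_mem:
  fixes S :: "('n::finite, 'k::comm_ring_1) mat_form set"
  assumes S: "form_subalgebra S" and trace: "\<And>bs. trace (word_mat bs) \<in> S"
    and "distinct ps" "inj_on \<sigma> (set ps)" "\<sigma> ` set ps \<subseteq> set ps"
  shows "(\<Sum>J\<in>set ps \<rightarrow>\<^sub>E UNIV. prod_list (map (\<lambda>i. word_mat (w i) $ J (\<sigma> i) $ J i) ps)) \<in> S"
  using assms(3-5)
proof (induction "length ps" arbitrary: ps \<sigma> w)
  case 0
  then show ?case by (simp add: form_subalgebraD(3)[OF S])
next
  case (Suc m)
  then obtain a qs where ps: "ps = a # qs" by (cases ps) auto
  let ?f = "\<lambda>w \<sigma> J i. word_mat (w i) $ J (\<sigma> i) $ J i :: ('n, 'k) mat_form"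
  have a: "a \<notin> set qs" using Suc.prems by (simp add: ps)
  show ?case
  proof (cases "\<sigma> a = a")
    case True
    \<comment> \<open>No factor other than that of \<open>a\<close> refers to the index at
      \<open>a\<close>, so the sum over this index splits off.\<close>
    have ne: "i \<noteq> a" "\<sigma> i \<noteq> a" if "i \<in> set qs" for i
      using that a Suc.prems(2) True by (auto simp: ps inj_on_def)
    have "(\<Sum>J\<in>set ps \<rightarrow>\<^sub>E UNIV. prod_list (map (?f w \<sigma> J) ps)) =
      (\<Sum>J\<in>set qs \<rightarrow>\<^sub>E UNIV. \<Sum>x\<in>UNIV. prod_list (map (?f w \<sigma> (J(a := x))) ps))"
      unfolding ps list.set by (rule sum_PiE_insert[OF a])
    also have "\<dots> = (\<Sum>J\<in>set qs \<rightarrow>\<^sub>E UNIV. \<Sum>x\<in>UNIV. word_mat (w a) $ x $ x * prod_list (map (?f w \<sigma> J) qs))"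
    proof (intro sum.cong refl)
      fix J :: "'a \<Rightarrow> 'n" and x
      have "map (?f w \<sigma> (J(a := x))) qs = map (?f w \<sigma> J) qs" using ne by simp
      then show "prod_list (map (?f w \<sigma> (J(a := x))) ps) =
        word_mat (w a) $ x $ x * prod_list (map (?f w \<sigma> J) qs)"
        using True by (simp only: ps list.map prod_list.Cons fun_upd_same)
    qed
    also have "\<dots> = trace (word_mat (w a)) * (\<Sum>J\<in>set qs \<rightarrow>\<^sub>E UNIV. prod_list (map (?f w \<sigma> J) qs))"
      by (simp add: trace_def sum_distrib_left sum_distrib_right)
    also have "\<dots> \<in> S"
    proof (rule form_subalgebraD(6)[OF S trace])
      have "\<sigma> ` set qs \<subseteq> set qs" using Suc.prems(3) ne(2) by (auto simp: ps)
      then show "(\<Sum>J\<in>set qs \<rightarrow>\<^sub>E UNIV. prod_list (map (?f w \<sigma> J) qs)) \<in> S"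
        using Suc.prems Suc.hyps(2) by (intro Suc.hyps(1)) (auto simp: ps)
    qed
    finally show ?thesis .
  next
    case False
    define b where "b = \<sigma> a"
    have "\<sigma> ` set ps = set ps" using Suc.prems by (intro endo_inj_surj) auto
    then obtain c where c: "c \<in> set ps" "\<sigma> c = a" by (force simp: ps)
    then have "c \<in> set qs" using False by (auto simp: ps)
    then obtain q1 q2 where qs: "qs = q1 @ c # q2" by (auto dest: split_list)
    have b: "b \<in> set qs" using Suc.prems(3) False by (auto simp: ps b_def)
    have ne: "i \<noteq> a" "i \<noteq> c" "\<sigma> i \<noteq> a" if "i \<in> set q1 \<union> set q2" for i
      using that a c Suc.prems by (auto simp: ps qs inj_on_def)
    \<comment> \<open>The index at \<open>a\<close> becomes the summation index of a matrix product:
      the words of \<open>a\<close> and \<open>c\<close> are concatenated, and the path from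
      \<open>c\<close> through \<open>a\<close> to \<open>b\<close> is shortened to one from
      \<open>c\<close> to \<open>b\<close>.\<close>
    let ?ps = "c # q1 @ q2" and ?w = "w(c := w a @ w c)" and ?\<sigma> = "\<sigma>(c := b)"
    have set_eq: "set ?ps = set qs" by (auto simp: qs)
    \<comment> \<open>The factor of \<open>c\<close> moves left past those of \<open>q1\<close>,
      next to the factor of \<open>a\<close>.\<close>
    obtain s where s: "s \<in> {1, - 1}" "\<And>J. prod_list (map (?f w \<sigma> J) q1) * ?f w \<sigma> J c =
      s * (?f w \<sigma> J c * prod_list (map (?f w \<sigma> J) q1))"
      using prod_list_sign_commute[of w \<sigma> q1 "w c" "\<sigma> c" c] by blast
    have "(\<Sum>J\<in>set ps \<rightarrow>\<^sub>E UNIV. prod_list (map (?f w \<sigma> J) ps)) =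
      (\<Sum>J\<in>set qs \<rightarrow>\<^sub>E UNIV. \<Sum>x\<in>UNIV. prod_list (map (?f w \<sigma> (J(a := x))) ps))"
      unfolding ps list.set by (rule sum_PiE_insert[OF a])
    also have "\<dots> = (\<Sum>J\<in>set qs \<rightarrow>\<^sub>E UNIV. \<Sum>x\<in>UNIV.
      s * (word_mat (w a) $ J b $ x * word_mat (w c) $ x $ J c * prod_list (map (?f ?w ?\<sigma> J) (q1 @ q2))))"
    proof (intro sum.cong refl)
      fix J :: "'a \<Rightarrow> 'n" and x
      let ?J = "J(a := x)"
      let ?P = "prod_list (map (?f w \<sigma> ?J) q1)" and ?Q = "prod_list (map (?f w \<sigma> ?J) q2)"
      have eq: "map (?f ?w ?\<sigma> J) q1 = map (?f w \<sigma> ?J) q1" "map (?f ?w ?\<sigma> J) q2 = map (?f w \<sigma> ?J) q2"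
        using ne by auto
      have "prod_list (map (?f w \<sigma> ?J) ps) = ?f w \<sigma> ?J a * (?P * ?f w \<sigma> ?J c) * ?Q"
        by (simp add: ps qs mult.assoc)
      also have "\<dots> = s * (?f w \<sigma> ?J a * ?f w \<sigma> ?J c * (?P * ?Q))"
        unfolding s(2) using s(1) by (auto simp: mult.assoc)
      also have "?f w \<sigma> ?J a = word_mat (w a) $ J b $ x"
        using b a by (auto simp: b_def)
      also have "?f w \<sigma> ?J c = word_mat (w c) $ x $ J c"
        using c \<open>c \<in> set qs\<close> a by auto
      finally show "prod_list (map (?f w \<sigma> ?J) ps) =
        s * (word_mat (w a) $ J b $ x * word_mat (w c) $ x $ J c * prod_list (map (?f ?w ?\<sigma> J) (q1 @ q2)))"
        by (simp only: map_append prod_list.append eq)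
    qed
    also have "\<dots> = s * (\<Sum>J\<in>set ?ps \<rightarrow>\<^sub>E UNIV. prod_list (map (?f ?w ?\<sigma> J) ?ps))"
    proof -
      have "?f ?w ?\<sigma> J c = (\<Sum>x\<in>UNIV. word_mat (w a) $ J b $ x * word_mat (w c) $ x $ J c)" for J
        by (simp add: word_mat_append matrix_matrix_mult_def)
      then show ?thesis
        unfolding set_eq list.map prod_list.Cons by (simp only: sum_distrib_left sum_distrib_right)
    qed
    also have "\<dots> \<in> S"
    proof (rule form_subalgebra_sign[OF S s(1)], rule Suc.hyps(1))
      show "m = length ?ps" using Suc.hyps(2) by (simp add: ps qs)
      show "distinct ?ps" using Suc.prems(1) by (auto simp: ps qs)
      show "inj_on ?\<sigma> (set ?ps)"
        using Suc.prems(2) a unfolding set_eq b_def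
        by (auto simp: ps inj_on_def)
      show "?\<sigma> ` set ?ps \<subseteq> set ?ps"
        using Suc.prems(3) b ne(3) unfolding set_eq by (auto simp: ps qs)
    qed
    finally show ?thesis .
  qed
qed

section \<open>Invariant forms\<close>

lemma matrix_inv_cancel:
  assumes "invertible A"
  shows "A ** matrix_inv A = mat 1" "matrix_inv A ** A = mat 1"
  using someI_ex[OF assms[unfolded invertible_def]] by (simp_all add: matrix_inv_def)

lemma invertible_transposeI:
  fixes A :: "'a::comm_ring_1 ^'n::finite ^'n"
  assumes "invertible A"
  shows "invertible (transpose A)"
  using matrix_inv_cancel[OF assms]
  by (auto simp: invertible_def matrix_transpose_mul[symmetric] transpose_mat
      intro!: exI[of _ "transpose (matrix_inv A)"])

lemma tensor_power_mult:
  fixes A B :: "'k::comm_ring_1 ^'n::finite ^'n"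
  shows "(\<Sum>K\<in>multi_index m. tensor_power m A I K * tensor_power m B K J) = tensor_power m (A ** B) I J"
proof -
  have "tensor_power m (A ** B) I J = (\<Prod>i<m. \<Sum>k\<in>UNIV. A $ I i $ k * B $ k $ J i)"
    by (simp add: tensor_power_def matrix_matrix_mult_def)
  also have "\<dots> = (\<Sum>K\<in>multi_index m. \<Prod>i<m. A $ I i $ K i * B $ K i $ J i)"
    unfolding multi_index_def by (rule prod_sum_PiE) auto
  finally show ?thesis by (simp add: tensor_power_def prod.distrib)
qed

lemma tensor_power_one:
  assumes "I \<in> multi_index m" "J \<in> multi_index m"
  shows "tensor_power m (mat 1) I J = (if I = J then 1 else 0)"
  using prod_multi_index_delta[OF assms] by (simp add: tensor_power_def mat_def)

text \<open>A word is split into its pattern of kinds, its row indices and its column indices. For a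
  fixed pattern the coefficients form a matrix in \<open>I\<close> and \<open>J\<close>, to which
  the description of the commutant applies.\<close>

definition index_word :: "nat \<Rightarrow> (nat \<Rightarrow> bool) \<Rightarrow> (nat \<Rightarrow> 'n) \<Rightarrow> (nat \<Rightarrow> 'n) \<Rightarrow> 'n letter list" where
  "index_word m B I J = map (\<lambda>i. (B i, I i, J i)) [0..<m]"

lemma sum_index_words:
  "(\<Sum>as | length as = m. f as) =
    (\<Sum>B\<in>multi_index m. \<Sum>I\<in>multi_index m. \<Sum>J\<in>multi_index m. f (index_word m B I J))"
proof -
  have "(\<Sum>as | length as = m. f as) = (\<Sum>x\<in>multi_index m \<times> multi_index m \<times> multi_index m.
    f (index_word m (fst x) (fst (snd x)) (snd (snd x))))"
    by (rule sum.reindex_bij_witness[of _ "\<lambda>x. index_word m (fst x) (fst (snd x)) (snd (snd x))"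
        "\<lambda>as. (\<lambda>i\<in>{..<m}. fst (as ! i), \<lambda>i\<in>{..<m}. fst (snd (as ! i)), \<lambda>i\<in>{..<m}. snd (snd (as ! i)))"])
      (auto simp: index_word_def multi_index_def PiE_def extensional_def fun_eq_iff
        intro!: nth_equalityI arg_cong[where f = f])
  then show ?thesis by (simp add: sum.cartesian_product case_prod_unfold)
qed

lemma prod_list_upt: "prod_list (map f [0..<m]) = (\<Prod>i<m. f i :: 'a::comm_monoid_mult)"
  by (simp add: prod.distinct_set_conv_list[symmetric] lessThan_atLeast0)

text \<open>Patterns of kinds do not mix under conjugation; within one pattern, row indices
  transform by the tensor power of \<open>g\<close> and column indices by that of its
  inverse.\<close>

lemma prod_conj_coeff:
  assumes "B' \<in> multi_index m" "B \<in> multi_index m"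
  shows "prod_list (map2 (conj_coeff g) (index_word m B' K L) (index_word m B I J)) =
    (if B' = B then tensor_power m g K I * tensor_power m (matrix_inv g) J L else 0)"
proof -
  have "prod_list (map2 (conj_coeff g) (index_word m B' K L) (index_word m B I J)) =
    (\<Prod>i<m. (if B' i = B i then 1 else 0) * (g $ K i $ I i * matrix_inv g $ J i $ L i))"
    unfolding index_word_def map2_map_map prod_list_upt
    by (intro prod.cong) (auto simp: conj_coeff_def)
  then show ?thesis
    using prod_multi_index_delta[OF assms, where 'a = 'a]
    by (simp add: prod.distrib tensor_power_def)
qed

lemma form_coeff_invariant:
  fixes g :: "'k::field_char_0 ^'n::finite ^'n"
  assumes "pullback g x = x" "B \<in> multi_index m" "I \<in> multi_index m" "J \<in> multi_index m"
  shows "form_coeff (index_word m B I J) x = (\<Sum>K\<in>multi_index m. \<Sum>L\<in>multi_index m.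
    tensor_power m g K I * tensor_power m (matrix_inv g) J L * form_coeff (index_word m B K L) x)"
proof -
  have "form_coeff (index_word m B I J) x = (\<Sum>bs | length bs = m.
      prod_list (map2 (conj_coeff g) bs (index_word m B I J)) * form_coeff bs x)"
    using form_coeff_pullback[OF is_pullback_pullback, of "index_word m B I J" g x] assms(1)
    by (simp add: index_word_def)
  also have "\<dots> = (\<Sum>B'\<in>multi_index m. if B' = B then \<Sum>K\<in>multi_index m. \<Sum>L\<in>multi_index m.
    tensor_power m g K I * tensor_power m (matrix_inv g) J L * form_coeff (index_word m B K L) x else 0)"
    unfolding sum_index_words by (intro sum.cong refl) (auto simp: prod_conj_coeff assms)
  also have "\<dots> = (\<Sum>K\<in>multi_index m. \<Sum>L\<in>multi_index m.
    tensor_power m g K I * tensor_power m (matrix_inv g) J L * form_coeff (index_word m B K L) x)"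
    using assms(2) by (subst sum.delta) auto
  finally show ?thesis .
qed

text \<open>Multiplying the invariance relation by a tensor power on the right cancels the tensor
  power of the inverse and leaves a commutation relation.\<close>

lemma form_coeff_commutes:
  fixes x :: "('n::finite, 'k::field_char_0) mat_form"
  assumes x: "x \<in> invariant_forms" and B: "B \<in> multi_index m" and h: "invertible h"
  shows "commutes_on (multi_index m) (\<lambda>I J. form_coeff (index_word m B I J) x) (tensor_power m h)"
  unfolding commutes_on_def
proof (intro ballI)
  let ?W = "multi_index m :: (nat \<Rightarrow> 'n) set"
  let ?t = "\<lambda>I J. form_coeff (index_word m B I J) x"
  \<comment> \<open>Row indices enter the invariance relation transposed, so invariance is applied
    to the transpose of \<open>h\<close>.\<close>
  define g where "g = transpose h"
  have g: "invertible g" using h by (simp add: g_def invertible_transposeI)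
  have tg: "tensor_power m g K I = tensor_power m h I K" for I K
    by (simp add: tensor_power_def g_def transpose_def)
  have inv: "pullback g x = x" using x g by (simp add: invariant_forms_def)
  fix I J assume IJ: "I \<in> ?W" "J \<in> ?W"
  have "(\<Sum>M\<in>?W. ?t I M * tensor_power m h M J) = (\<Sum>M\<in>?W. \<Sum>K\<in>?W. \<Sum>L\<in>?W.
    tensor_power m h I K * ?t K L * (tensor_power m g J M * tensor_power m (matrix_inv g) M L))"
  proof (intro sum.cong refl)
    fix M assume M: "M \<in> ?W"
    show "?t I M * tensor_power m h M J = (\<Sum>K\<in>?W. \<Sum>L\<in>?W.
      tensor_power m h I K * ?t K L * (tensor_power m g J M * tensor_power m (matrix_inv g) M L))"
      unfolding form_coeff_invariant[OF inv B IJ(1) M] tg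
      by (simp add: sum_distrib_left sum_distrib_right mult_ac)
  qed
  also have "\<dots> = (\<Sum>K\<in>?W. \<Sum>L\<in>?W. tensor_power m h I K * ?t K L *
      (\<Sum>M\<in>?W. tensor_power m g J M * tensor_power m (matrix_inv g) M L))"
    unfolding sum_distrib_left by (rule trans[OF sum.swap], rule sum.cong[OF refl], rule sum.swap)
  also have "\<dots> = (\<Sum>K\<in>?W. \<Sum>L\<in>?W. if J = L then tensor_power m h I K * ?t K L else 0)"
    by (intro sum.cong refl) (simp add: tensor_power_mult matrix_inv_cancel[OF g] tensor_power_one IJ)
  also have "\<dots> = (\<Sum>K\<in>?W. tensor_power m h I K * ?t K J)"
    using IJ by (simp add: sum.delta)
  finally show "(\<Sum>M\<in>?W. ?t I M * tensor_power m h M J) = (\<Sum>K\<in>?W. tensor_power m h I K * ?t K J)" .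
qed

section \<open>Invariant forms lie in the subalgebra generated by traces\<close>

lemma form_scalar_sum: "form_scalar (\<Sum>x\<in>A. f x) = (\<Sum>x\<in>A. form_scalar (f x))"
  by (induction A rule: infinite_finite_induct) (simp_all add: form_scalar_add)

text \<open>Writing the coefficients as a combination of permutation operators ties \<open>I\<close>
  to \<open>J\<close>; the remaining sum over \<open>J\<close> is a contraction of one-letter words
  along a permutation.\<close>

lemma form_component_mem:
  fixes S :: "('n::finite, 'k::field_char_0) mat_form set"
  assumes S: "form_subalgebra S" and trace: "\<And>bs. trace (word_mat bs) \<in> S"
    and x: "x \<in> invariant_forms"
  shows "form_component m x \<in> S"
proof -
  let ?W = "multi_index m :: (nat \<Rightarrow> 'n) set"
  have "(\<Sum>I\<in>?W. \<Sum>J\<in>?W. form_scalar (form_coeff (index_word m B I J) x) * letter_word (index_word m B I J)) \<in> S"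
    (is "?sum \<in> S") if B: "B \<in> multi_index m" for B
  proof -
    let ?w = "\<lambda>I J. letter_word (index_word m B I J) :: ('n, 'k) mat_form"
    obtain c where c: "form_coeff (index_word m B I J) x =
      (\<Sum>\<rho>\<in>perms m. \<Sum>\<sigma>\<in>perms m. if I = J \<circ> \<sigma> \<circ> inv \<rho> then c \<rho> \<sigma> else 0)" if "I \<in> ?W" "J \<in> ?W" for I J
      using commutant_of_tensor_powers[OF form_coeff_commutes[OF x B]] by blast
    have contraction: "(\<Sum>J\<in>?W. ?w (J \<circ> \<sigma>) J) \<in> S" if "\<sigma> permutes {..<m}" for \<sigma>
    proof -
      have "(\<Sum>J\<in>set [0..<m] \<rightarrow>\<^sub>E UNIV. prod_list (map (\<lambda>i. word_mat [B i] $ J (\<sigma> i) $ J i) [0..<m])) \<in> S"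
        using permutes_inj_on[OF that] permutes_image[OF that]
        by (intro contraction_mem[OF S trace]) (auto simp: lessThan_atLeast0)
      then show ?thesis
        by (simp add: multi_index_def lessThan_atLeast0 letter_word_def index_word_def letter_def comp_def)
    qed
    have "?sum = (\<Sum>I\<in>?W. \<Sum>J\<in>?W. \<Sum>\<rho>\<in>perms m. \<Sum>\<sigma>\<in>perms m.
      if I = J \<circ> \<sigma> \<circ> inv \<rho> then form_scalar (c \<rho> \<sigma>) * ?w I J else 0)"
      by (intro sum.cong refl)
        (simp add: c form_scalar_sum sum_distrib_right if_distrib[of form_scalar] if_distrib[of "\<lambda>y. y * _"] cong: if_cong)
    also have "\<dots> = (\<Sum>\<rho>\<in>perms m. \<Sum>\<sigma>\<in>perms m. \<Sum>J\<in>?W. \<Sum>I\<in>?W.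
      if I = J \<circ> \<sigma> \<circ> inv \<rho> then form_scalar (c \<rho> \<sigma>) * ?w I J else 0)"
      by (subst sum.swap) (simp only: sum.swap[of _ "perms m" ?W])
    also have "\<dots> = (\<Sum>\<rho>\<in>perms m. \<Sum>\<sigma>\<in>perms m. form_scalar (c \<rho> \<sigma>) * (\<Sum>J\<in>?W. ?w (J \<circ> (\<sigma> \<circ> inv \<rho>)) J))"
    proof (intro sum.cong refl)
      fix \<rho> \<sigma> assume "\<rho> \<in> perms m" "\<sigma> \<in> perms m"
      then have "J \<circ> \<sigma> \<circ> inv \<rho> \<in> ?W" if "J \<in> ?W" for J
        using that by (auto intro: multi_index_comp permutes_inv)
      then show "(\<Sum>J\<in>?W. \<Sum>I\<in>?W. if I = J \<circ> \<sigma> \<circ> inv \<rho> then form_scalar (c \<rho> \<sigma>) * ?w I J else 0) =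
        form_scalar (c \<rho> \<sigma>) * (\<Sum>J\<in>?W. ?w (J \<circ> (\<sigma> \<circ> inv \<rho>)) J)"
        by (simp add: sum.delta sum_distrib_left o_assoc)
    qed
    also have "\<dots> \<in> S"
      by (intro form_subalgebra_sum[OF S] form_subalgebraD(6)[OF S] form_subalgebraD(1)[OF S] contraction)
        (auto intro: permutes_compose permutes_inv)
    finally show ?thesis .
  qed
  then show ?thesis
    unfolding form_component_def sum_index_words by (rule form_subalgebra_sum[OF S])
qed

lemma invariant_mem:
  fixes S :: "('n::finite, 'k::field_char_0) mat_form set"
  assumes S: "form_subalgebra S" and "\<And>bs. trace (word_mat bs) \<in> S" and "x \<in> invariant_forms"
  shows "x \<in> S"
proof -
  obtain N where N: "x = (\<Sum>m<N. form_scalar (1 / fact m) * form_component m x)"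
    using form_expansion by blast
  have "(\<Sum>m<N. form_scalar (1 / fact m) * form_component m x) \<in> S"
    by (intro form_subalgebra_sum[OF S] form_subalgebraD(6)[OF S] form_subalgebraD(1)[OF S]
        form_component_mem assms)
  then show ?thesis using N by simp
qed

section \<open>Invariance of the generators\<close>

lemma map_matrix_mult:
  assumes "\<And>a b. F (a + b) = F a + F b" "\<And>a b. F (a * b) = F a * F b" "F 0 = 0"
  shows "map_matrix F (A ** B) = map_matrix F A ** map_matrix F (B :: 'a::semiring_1 ^'n::finite ^'n)"
proof -
  have "F (sum f T) = (\<Sum>x\<in>T. F (f x))" for f :: "'n \<Rightarrow> 'a" and T
    by (induction T rule: infinite_finite_induct) (simp_all add: assms)
  then show ?thesis by (simp add: vec_eq_iff matrix_matrix_mult_def assms)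
qed

lemma map_matrix_mat_one:
  assumes "F 0 = 0" "F 1 = 1"
  shows "map_matrix F (mat 1) = mat 1"
  using assms by (simp add: vec_eq_iff mat_def)

lemma conj_mat_mult:
  fixes A B :: "('n::finite, 'k::field) mat_form ^'n ^'n"
  assumes "invertible g"
  shows "conj_mat g (A ** B) = conj_mat g A ** conj_mat g B"
proof -
  let ?G = "map_matrix form_scalar g :: ('n, 'k) mat_form ^'n ^'n"
  let ?H = "map_matrix form_scalar (matrix_inv g) :: ('n, 'k) mat_form ^'n ^'n"
  have "?H ** ?G = mat 1"
    by (simp add: matrix_inv_cancel[OF assms] map_matrix_mat_one
        flip: map_matrix_mult[OF form_scalar_add form_scalar_mult form_scalar_0])
  then have "?G ** A ** (?H ** ?G) ** (B ** ?H) = ?G ** A ** (B ** ?H)" by simp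
  then show ?thesis by (simp add: conj_mat_def matrix_mul_assoc)
qed

lemma conj_mat_one:
  assumes "invertible g"
  shows "conj_mat g (mat 1) = mat 1"
  by (simp add: conj_mat_def matrix_inv_cancel[OF assms] map_matrix_mat_one
      flip: map_matrix_mult[OF form_scalar_add form_scalar_mult form_scalar_0])

text \<open>Scalars are central, so the outer factor from \<open>g\<close> can be rotated around the
  trace although the entries of \<open>A\<close> need not commute with each other.\<close>

lemma trace_conj_mat:
  fixes A :: "('n::finite, 'k::field) mat_form ^'n ^'n"
  assumes "invertible g"
  shows "trace (conj_mat g A) = trace A"
proof -
  let ?G = "map_matrix form_scalar g :: ('n, 'k) mat_form ^'n ^'n"
  let ?H = "map_matrix form_scalar (matrix_inv g) :: ('n, 'k) mat_form ^'n ^'n"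
  have "trace (?G ** (A ** ?H)) = trace (A ** ?H ** ?G)"
    unfolding trace_def matrix_matrix_mult_def[of ?G] matrix_matrix_mult_def[of "A ** ?H"]
    by (simp add: form_scalar_commute) (rule sum.swap)
  also have "A ** ?H ** ?G = A"
    by (simp add: matrix_inv_cancel[OF assms] map_matrix_mat_one
        flip: matrix_mul_assoc map_matrix_mult[OF form_scalar_add form_scalar_mult form_scalar_0])
  finally show ?thesis by (simp add: conj_mat_def matrix_mul_assoc)
qed

lemma trace_pullback:
  fixes A :: "('n::finite, 'k::field) mat_form ^'n ^'n"
  assumes "invertible g" "map_matrix (pullback g) A = conj_mat g A"
  shows "pullback g (trace A) = trace A"
proof -
  have hom: "form_alg_hom (pullback g)" using is_pullback_pullback by (auto simp: is_pullback_def)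
  have "pullback g 0 = 0" using form_alg_homD(3)[OF hom, of 0] by simp
  then have "pullback g (sum f T) = (\<Sum>x\<in>T. pullback g (f x))" for f :: "'n \<Rightarrow> ('n, 'k) mat_form" and T
    by (induction T rule: infinite_finite_induct) (simp_all add: form_alg_homD(1)[OF hom])
  then have "pullback g (trace A) = trace (map_matrix (pullback g) A)"
    by (simp add: trace_def)
  then show ?thesis by (simp add: assms trace_conj_mat)
qed

text \<open>On \<open>X_mat\<close> and \<open>dX_mat\<close> the entrywise pullback is matrix
  conjugation. Multiplicativity carries this over to products, and the trace is unchanged by
  conjugation.\<close>

lemma generators_invariant:
  "trace (mat_power X_mat l) \<in> (invariant_forms :: ('n::finite, 'k::field) mat_form set)"
  "omega ls \<in> (invariant_forms :: ('n, 'k) mat_form set)"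
proof -
  let ?om = "\<lambda>ls. foldr (\<lambda>l M. mat_power X_mat l ** dX_mat ** M) ls (mat 1 :: ('n, 'k) mat_form ^'n ^'n)"
  have *: "map_matrix (pullback g) (mat_power X_mat l) = conj_mat g (mat_power X_mat l :: ('n, 'k) mat_form ^'n ^'n)"
    "map_matrix (pullback g) (?om ls) = conj_mat g (?om ls)"
    if g: "invertible g" for g :: "'k ^'n ^'n" and l ls
  proof -
    have P: "is_pullback g (pullback g)" by (rule is_pullback_pullback)
    then have hom: "form_alg_hom (pullback g)" by (simp add: is_pullback_def)
    have zero: "pullback g 0 = 0" using form_alg_homD(3)[OF hom, of 0] by simp
    have one: "pullback g 1 = 1" using form_alg_homD(3)[OF hom, of 1] by simp
    note mult = map_matrix_mult[OF form_alg_homD(1,2)[OF hom] zero]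
    have X: "map_matrix (pullback g) X_mat = conj_mat g (X_mat :: ('n, 'k) mat_form ^'n ^'n)"
      and dX: "map_matrix (pullback g) dX_mat = conj_mat g (dX_mat :: ('n, 'k) mat_form ^'n ^'n)"
      using P by (simp_all add: vec_eq_iff is_pullback_def)
    have power: "map_matrix (pullback g) (mat_power X_mat l) =
      conj_mat g (mat_power X_mat l :: ('n, 'k) mat_form ^'n ^'n)" for l
      by (induction l) (simp_all add: mult X conj_mat_mult[OF g] conj_mat_one[OF g] map_matrix_mat_one zero one)
    then show "map_matrix (pullback g) (mat_power X_mat l) =
      conj_mat g (mat_power X_mat l :: ('n, 'k) mat_form ^'n ^'n)" .
    show "map_matrix (pullback g) (?om ls) = conj_mat g (?om ls)"
      by (induction ls)
        (simp_all add: mult dX power conj_mat_mult[OF g] conj_mat_one[OF g] map_matrix_mat_one zero one)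
  qed
  then show "trace (mat_power X_mat l) \<in> (invariant_forms :: ('n, 'k) mat_form set)"
    "omega ls \<in> (invariant_forms :: ('n, 'k) mat_form set)"
    by (auto simp: invariant_forms_def omega_def trace_pullback)
qed

lemma form_subalgebra_invariant_forms: "form_subalgebra invariant_forms"
proof -
  have "form_alg_hom (pullback g)" for g :: "'b ^'a ^'a"
    using is_pullback_pullback by (auto simp: is_pullback_def)
  then show ?thesis by (simp add: form_subalgebra_def invariant_forms_def form_alg_homD)
qed

theorem theorem1:
  shows "(invariant_forms :: ('n::finite, 'k::field_char_0) mat_form set) =
    form_subalgebra hull
      ({trace (mat_power X_mat l) | l. l \<ge> 1} \<union> {omega ls | ls. ls \<noteq> []})"
proof (rule antisym)
  let ?T = "{trace (mat_power X_mat l) | l. l \<ge> 1} \<union> {omega ls | ls. ls \<noteq> []} :: ('n, 'k) mat_form set"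
  show "form_subalgebra hull ?T \<subseteq> invariant_forms"
    using form_subalgebra_invariant_forms generators_invariant by (intro hull_minimal) auto
  show "invariant_forms \<subseteq> form_subalgebra hull ?T"
  proof
    fix x :: "('n, 'k) mat_form" assume x: "x \<in> invariant_forms"
    show "x \<in> form_subalgebra hull ?T"
      \<comment> \<open>It suffices to consider one subalgebra \<open>S\<close> containing the
        generators: it contains all traces of words, hence every invariant form.\<close>
      unfolding hull_def
    proof (intro InterI, clarify)
      fix S assume S: "form_subalgebra S" "?T \<subseteq> S"
      then have "trace (word_mat bs) \<in> S" for bs
        by (intro trace_word_mat_mem) auto
      then show "x \<in> S" using invariant_mem[OF S(1) _ x] by blast
    qed
  qed
qed

end
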